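(* Let $\Sigma$ be the normal fan of a simple convex polytope $P\subset\mathbb{R}^d$ of dimension $d$ with $n$ facets, and let $U\in\mathbb{R}^{n\times d}$ be its ray matrix. Let $\Delta\subseteq P$ be a face of $P$ which is a simplex of dimension $d-k>0$. The $(n-k-2)$-dimensional linear space in $\mathbb{P}^{n-1}$ given by $W_\Delta(x)=x_{\sigma_\Delta}=0$ is contained in $\mathcal{A}_\Sigma\cap\overline{{\rm Ch}(U)}_{n-1}$.
   Context: $\Sigma$ is the inner normal fan of $P$; it is simplicial and its rays $\Sigma(1)$ are identified with the facets of $P$. The ray matrix $U$ has rows $u_\rho$, $\rho\in\Sigma(1)$, with $u_\rho$ a nonzero generator of $\rho$. $\Sigma(d)$ is the set of $d$-dimensional cones, $\sigma(1)$ the rays of $\sigma$, $U_\sigma$ the submatrix with rows indexed by $\sigma(1)$. ${\rm Adj}_\Sigma(x)=\sum_{\sigma\in\Sigma(d)}|\det U_\sigma|\prod_{\rho\notin\sigma(1)}x_\rho$ and $\mathcal{A}_\Sigma=\{x\in\mathbb{P}^{n-1}:{\rm Adj}_\Sigma(x)=0\}$ in complex projective space with homogeneous coordinates $x_\rho$. For a face $\Delta\subseteq P$, $\sigma_\Delta\in\Sigma$ is its normal cone, generated by the rays of the facets containing $\Delta$. If $\Delta$ is a simplex of dimension $d-k>0$, ${\rm nb}(\Delta)$ is the set of the $d-k+1$ facets of $P$ (rays of $\Sigma$) which intersect $\Delta$ in one of its facets. Define the $(d+1)\times(d+1)$ determinant (well defined up to sign) $$W_\Delta(x)=\det\begin{pmatrix}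 U_{{\rm nb}(\Delta)} & x_{{\rm nb}(\Delta)} \\ U_{\sigma_\Delta} & x_{\sigma_\Delta} \end{pmatrix},$$ where $U_{{\rm nb}(\Delta)},U_{\sigma_\Delta}$ are the submatrices of $U$ with rows indexed by ${\rm nb}(\Delta)$ and $\sigma_\Delta(1)$, and $x_{{\rm nb}(\Delta)},x_{\sigma_\Delta}$ are the corresponding subvectors of the column vector $x$. "$x_{\sigma_\Delta}=0$" means $x_\rho=0$ for all $\rho\in\sigma_\Delta(1)$. Chamber complex: for $I\subseteq\Sigma(1)$ let $\tilde C_I\subseteq\mathbb{R}^n$ be the cone generated by the standard basis vectors $e_\rho$, $\rho\in I$, and $C_I=\tilde C_I+{\rm im}(U)$, with ${\rm im}(U)\subset\mathbb{R}^n$ the column span of $U$. For $x\in\mathbb{R}^n$ let $C_x$ be the intersection of all cones $C_I$ containing $x$ (and $C_x=\emptyset$ if there are none). ${\rm Ch}(U)=\{C_x:x\in\mathbb{R}^n\}$, a fan in $\mathbb{R}^n$. Its $(n-1)$-skeleton is the union of its $(n-1)$-dimensional cones, and $\overline{{\rm Ch}(U)}_{n-1}\subset\mathbb{P}^{n-1}$ is the projectivization of the (complex) Zariski closure of the $(n-1)$-skeleton. *)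

theory Defs
  imports "HOL-Analysis.Analysis"
begin

definition simple_polytope :: "'a::euclidean_space set \<Rightarrow> bool" where
  "simple_polytope P \<longleftrightarrow> polytope P \<and>
     (\<forall>v. v extreme_point_of P \<longrightarrow> int (card {F. F facet_of P \<and> v \<in> F}) = aff_dim P)"

definition normal_cone :: "'a::euclidean_space set \<Rightarrow> 'a set \<Rightarrow> 'a set" where
  "normal_cone P F = {u. \<forall>y\<in>F. \<forall>z\<in>P. u \<bullet> y \<le> u \<bullet> z}"

definition normal_fan :: "'a::euclidean_space set \<Rightarrow> 'a set set" where
  "normal_fan P = {normal_cone P F | F. F face_of P \<and> F \<noteq> {}}"

text \<open>All nonempty cones below contain the origin, so \<^const>\<open>aff_dim\<close> is the dimension of the
  linear span; the empty chamber has \<^const>\<open>aff_dim\<close> \<open>-1\<close> and is never selected.\<close>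

definition cones_of_dim :: "nat \<Rightarrow> 'a::euclidean_space set set \<Rightarrow> 'a set set" where
  "cones_of_dim k \<Sigma> = {\<sigma> \<in> \<Sigma>. aff_dim \<sigma> = int k}"

text \<open>The rays of the fan are indexed by the finite type \<open>'n\<close>, so subsets of \<open>\<Sigma>(1)\<close> become sets of
  type \<open>'n set\<close>; row \<open>i\<close> of the ray matrix is \<open>U $ i\<close>.\<close>

definition ray :: "real^'d^'n \<Rightarrow> 'n \<Rightarrow> (real^'d) set" where
  "ray U i = conic hull {U $ i}"

definition ray_matrix_of :: "real^'d^'n \<Rightarrow> (real^'d) set set \<Rightarrow> bool" where
  "ray_matrix_of U \<Sigma> \<longleftrightarrow>
     (\<forall>i. U $ i \<noteq> 0) \<and> bij_betw (ray U) UNIV (cones_of_dim 1 \<Sigma>)"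

definition rays_of_cone :: "real^'d^'n \<Rightarrow> (real^'d) set \<Rightarrow> 'n set" where
  "rays_of_cone U \<sigma> = {i. ray U i face_of \<sigma>}"

text \<open>Determinant of the square submatrix with rows indexed by \<open>I\<close>, where \<open>card I = CARD('m)\<close>. The
  rows are ordered by an arbitrary enumeration of \<open>I\<close>, so it is meaningful up to sign.\<close>

definition row_minor :: "'a::comm_ring_1^'m^'n \<Rightarrow> 'n set \<Rightarrow> 'a" where
  "row_minor A I = (let e = (SOME e. bij_betw e (UNIV :: 'm set) I) in det (\<chi> j. A $ (e j)))"

lemma row_minor_up_to_sign:
  fixes A :: "'a::comm_ring_1^'m^'n" and e :: "'m \<Rightarrow> 'n"
  assumes e: "bij_betw e UNIV I"
  shows "row_minor A I = det (\<chi> j. A $ (e j)) \<or> row_minor A I = - det (\<chi> j. A $ (e j))"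
proof -
  define f where "f = (SOME f. bij_betw f (UNIV :: 'm set) I)"
  have f: "bij_betw f UNIV I"
    unfolding f_def by (rule someI[of "\<lambda>f. bij_betw f UNIV I", OF e])
  define p where "p = inv_into UNIV e \<circ> f"
  have "bij_betw p UNIV UNIV"
    unfolding p_def using bij_betw_trans[OF f bij_betw_inv_into[OF e]] .
  then have p: "p permutes UNIV"
    by (rule bij_imp_permutes) simp
  have ep: "e (p j) = f j" for j
    using bij_betw_inv_into_right[OF e, of "f j"] f by (auto simp: p_def bij_betw_def)
  have "row_minor A I = det (\<chi> j. (\<chi> j. A $ (e j)) $ p j)"
    by (simp add: row_minor_def Let_def f_def[symmetric] ep)
  also have "\<dots> = of_int (sign p) * det (\<chi> j. A $ (e j))"
    by (rule det_permute_rows[OF p])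
  finally show ?thesis
    by (auto simp: sign_def)
qed

text \<open>Points of the projective space \<open>\<P>(\<complex>\<^sup>n)\<close> are the one-dimensional linear subspaces of \<open>\<complex>\<^sup>n\<close>.\<close>

definition projectivization :: "(complex^'n) set \<Rightarrow> (complex^'n) set set" where
  "projectivization S = {vec.span {x} | x. x \<in> S \<and> x \<noteq> 0}"

definition proj_linear_space :: "int \<Rightarrow> (complex^'n) set set \<Rightarrow> bool" where
  "proj_linear_space m X \<longleftrightarrow>
     (\<exists>V. vec.subspace V \<and> int (vec.dim V) = m + 1 \<and> X = projectivization V)"

inductive polynomial_fun :: "(complex^'n \<Rightarrow> complex) \<Rightarrow> bool" where
  const: "polynomial_fun (\<lambda>x. c)"
| coord: "polynomial_fun (\<lambda>x. x $ i)"
| add: "polynomial_fun f \<Longrightarrow> polynomial_fun g \<Longrightarrow> polynomial_fun (\<lambda>x. f x + g x)"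
| mult: "polynomial_fun f \<Longrightarrow> polynomial_fun g \<Longrightarrow> polynomial_fun (\<lambda>x. f x * g x)"

definition zariski_closure :: "(complex^'n) set \<Rightarrow> (complex^'n) set" where
  "zariski_closure S = {x. \<forall>f. polynomial_fun f \<longrightarrow> (\<forall>y\<in>S. f y = 0) \<longrightarrow> f x = 0}"

definition Adj :: "(real^'d) set set \<Rightarrow> real^'d^'n \<Rightarrow> complex^'n \<Rightarrow> complex" where
  "Adj \<Sigma> U x = (\<Sum>\<sigma>\<in>cones_of_dim CARD('d) \<Sigma>.
     of_real \<bar>row_minor U (rays_of_cone U \<sigma>)\<bar> * (\<Prod>i\<in>- rays_of_cone U \<sigma>. x $ i))"

definition adjoint_hypersurface :: "(real^'d) set set \<Rightarrow> real^'d^'n \<Rightarrow> (complex^'n) set set" where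
  "adjoint_hypersurface \<Sigma> U = projectivization {x. Adj \<Sigma> U x = 0}"

definition coordinate_cone :: "'n set \<Rightarrow> (real^'n) set" where
  "coordinate_cone I = convex_cone hull ((\<lambda>i. axis i 1) ` I)"

definition chamber_cone :: "real^'d^'n \<Rightarrow> 'n set \<Rightarrow> (real^'n) set" where
  "chamber_cone U I = {a + b | a b. a \<in> coordinate_cone I \<and> b \<in> span (columns U)}"

definition chamber :: "real^'d^'n \<Rightarrow> real^'n \<Rightarrow> (real^'n) set" where
  "chamber U x = (if \<exists>I. x \<in> chamber_cone U I
     then \<Inter> {chamber_cone U I | I. x \<in> chamber_cone U I} else {})"

definition chamber_complex :: "real^'d^'n \<Rightarrow> (real^'n) set set" where
  "chamber_complex U = range (chamber U)"

definition fan_skeleton :: "nat \<Rightarrow> (real^'n) set set \<Rightarrow> (real^'n) set" where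
  "fan_skeleton m \<F> = \<Union> (cones_of_dim m \<F>)"

definition complexify :: "real^'n \<Rightarrow> complex^'n" where
  "complexify x = (\<chi> i. of_real (x $ i))"

definition proj_skeleton_closure :: "nat \<Rightarrow> (real^'n) set set \<Rightarrow> (complex^'n) set set" where
  "proj_skeleton_closure m \<F> =
     projectivization (zariski_closure (complexify ` fan_skeleton m \<F>))"

definition neighbours :: "(real^'d) set \<Rightarrow> real^'d^'n \<Rightarrow> (real^'d) set \<Rightarrow> 'n set" where
  "neighbours P U \<Delta> =
     {i. \<exists>F. F facet_of P \<and> normal_cone P F = ray U i \<and> (F \<inter> \<Delta>) facet_of \<Delta>}"

text \<open>The matrix \<open>U\<close> with the extra column \<open>x\<close>, which has index \<^const>\<open>None\<close>.\<close>

definition augmented :: "real^'d^'n \<Rightarrow> complex^'n \<Rightarrow> complex^('d option)^'n" where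
  "augmented U x = (\<chi> i j. case j of None \<Rightarrow> x $ i | Some c \<Rightarrow> of_real (U $ i $ c))"

definition W :: "(real^'d) set \<Rightarrow> real^'d^'n \<Rightarrow> (real^'d) set \<Rightarrow> complex^'n \<Rightarrow> complex" where
  "W P U \<Delta> x =
     row_minor (augmented U x) (neighbours P U \<Delta> \<union> rays_of_cone U (normal_cone P \<Delta>))"

definition W_space :: "(real^'d) set \<Rightarrow> real^'d^'n \<Rightarrow> (real^'d) set \<Rightarrow> (complex^'n) set set" where
  "W_space P U \<Delta> = projectivization
     {x. W P U \<Delta> x = 0 \<and> (\<forall>i\<in>rays_of_cone U (normal_cone P \<Delta>). x $ i = 0)}"

end

theory Submission
  imports Defs
begin

text \<open>
  The rays in \<open>nb(\<Delta>)\<close> and \<open>\<sigma>\<^sub>\<Delta>(1)\<close> together are \<open>d + 1\<close> vectors, of which the rays of the normal cone of a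
  vertex \<open>v\<close> of \<open>\<Delta>\<close> are all but the one of the facet opposite to \<open>v\<close>.  Hence they satisfy a linear
  relation \<open>\<Sum> c\<^sub>i u\<^sub>i = 0\<close>, unique up to scaling, and by Cramer's rule \<open>\<bar>c\<^sub>i\<bar>\<close> is proportional to the minor
  omitting row \<open>i\<close>.  Pairing the relation with an edge of \<open>\<Delta>\<close> shows that the \<open>c\<^sub>i\<close> with
  \<open>i \<in> nb(\<Delta>)\<close> have the same sign.  Therefore \<open>W\<^sub>\<Delta>(x) = 0\<close> means \<open>\<Sum> c\<^sub>i x\<^sub>i = 0\<close>, and on
  \<open>x\<^sub>\<sigma> = 0\<close>, where only the vertices of \<open>\<Delta>\<close> contribute to the adjoint, the adjoint is a multiple
  of the same form.  The real hyperplane \<open>\<Sum> c\<^sub>i x\<^sub>i = 0\<close> contains a cone \<open>C\<^sub>I\<close> with nonempty relative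
  interior; since there are finitely many closed cones \<open>C\<^sub>J\<close>, some relatively open piece of it meets
  only those \<open>C\<^sub>J\<close> that contain it, so its points lie in chambers of dimension \<open>n - 1\<close>, and the piece is
  Zariski dense in the complex hyperplane.
\<close>

section \<open>Facets, vertices and normal cones\<close>

lemma mem_conic_hull_singleton:
  fixes u :: "'a::euclidean_space"
  shows "w \<in> conic hull {u} \<longleftrightarrow> (\<exists>c\<ge>0. w = c *\<^sub>R u)"
  by (auto simp: conic_hull_explicit)

lemma aff_dim_ray:
  fixes u :: "'a::euclidean_space"
  assumes "u \<noteq> 0"
  shows "aff_dim (conic hull {u}) = 1"
proof -
  have "span (conic hull {u}) = span {u}"
    unfolding span_eq
  proof
    show "conic hull {u} \<subseteq> span {u}"
      by (auto simp: mem_conic_hull_singleton span_base span_scale)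
    show "{u} \<subseteq> span (conic hull {u})"
      by (simp add: span_base hull_inc)
  qed
  then have "dim (conic hull {u}) = dim {u}"
    by (metis dim_span)
  moreover have "0 \<in> conic hull {u}" by simp
  ultimately show ?thesis
    using assms by (simp add: aff_dim_zero hull_inc)
qed

text \<open>Full dimension makes the affine hull of a facet a whole hyperplane, so a functional
  constant on the facet is a multiple of its normal. The library normal \<open>a\<close> points
  outwards, hence the inner generator is \<open>- a\<close>.\<close>

lemma normal_cone_facet:
  fixes P :: "'a::euclidean_space set"
  assumes P: "polyhedron P" and full: "aff_dim P = DIM('a)" and F: "F facet_of P"
  obtains u where "u \<noteq> 0" "normal_cone P F = conic hull {u}"
    "F = {z\<in>P. \<forall>y\<in>P. u \<bullet> z \<le> u \<bullet> y}"
proof -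
  obtain a b where a: "a \<noteq> 0" and le: "P \<subseteq> {x. a \<bullet> x \<le> b}" and Feq: "F = P \<inter> {x. a \<bullet> x = b}"
    using facet_of_polyhedron[OF P F] .
  obtain f where f: "f \<in> F" using F by (auto simp: facet_of_def)
  have "aff_dim F = DIM('a) - 1"
    using F full by (simp add: facet_of_def)
  moreover have "affine hull F \<subseteq> {x. a \<bullet> x = b}"
    by (rule hull_minimal) (auto simp: Feq affine_hyperplane)
  ultimately have aff: "affine hull F = {x. a \<bullet> x = b}"
    using aff_dim_eq_full_gen[of "affine hull F" "{x. a \<bullet> x = b}"] a
    by (simp add: affine_hull_eq[THEN iffD2, OF affine_hyperplane] )
  obtain z where z: "z \<in> P" "a \<bullet> z < b"
  proof -
    have "\<not> P \<subseteq> {x. a \<bullet> x = b}"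
      using aff_dim_subset[of P "{x. a \<bullet> x = b}"] a full by auto
    then show ?thesis using le that by force
  qed
  have "normal_cone P F = conic hull {- a}"
  proof (intro subset_antisym subsetI)
    fix w assume w: "w \<in> normal_cone P F"
    have "F \<subseteq> {x. w \<bullet> x = w \<bullet> f}"
      using w f by (auto simp: normal_cone_def Feq intro!: antisym)
    then have hull: "affine hull F \<subseteq> {x. w \<bullet> x = w \<bullet> f}"
      by (rule hull_minimal) (rule affine_hyperplane)
    \<comment> \<open>Split \<open>w\<close> into its component along \<open>a\<close> and the rest
      \<open>h\<close>. Since \<open>h\<close> is a direction of the hyperplane, on which
      \<open>w\<close> is constant, it is orthogonal to \<open>w\<close>, hence to itself.\<close>
    define c where "c = (w \<bullet> a) / (a \<bullet> a)"
    define h where "h = w - c *\<^sub>R a"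
    have ah: "a \<bullet> h = 0"
      using a by (simp add: h_def c_def inner_diff_right inner_commute)
    then have "f + h \<in> affine hull F"
      using f unfolding aff by (simp add: Feq inner_add_right)
    then have "w \<bullet> h = 0"
      using hull by (auto simp: inner_add_right)
    then have "h \<bullet> h = 0"
      using ah by (subst (1) h_def) (simp add: inner_diff_left)
    then have wc: "w = c *\<^sub>R a"
      by (simp add: h_def)
    \<comment> \<open>The point \<open>z\<close> of \<open>P\<close> off the hyperplane determines
      the sign of \<open>c\<close>.\<close>
    have "w \<bullet> f \<le> w \<bullet> z"
      using w f z by (auto simp: normal_cone_def)
    then have "c * (b - a \<bullet> z) \<le> 0"
      using f by (simp add: wc Feq algebra_simps)
    then have "c \<le> 0"
      using z(2) by (simp add: mult_le_0_iff)
    then have "w = (- c) *\<^sub>R (- a)" "- c \<ge> 0"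
      by (auto simp: wc)
    then show "w \<in> conic hull {- a}"
      unfolding mem_conic_hull_singleton by blast
  next
    fix w assume "w \<in> conic hull {- a}"
    then show "w \<in> normal_cone P F"
      using le by (auto simp: mem_conic_hull_singleton normal_cone_def Feq intro!: mult_left_mono)
  qed
  moreover have "F = {z\<in>P. \<forall>y\<in>P. (- a) \<bullet> z \<le> (- a) \<bullet> y}"
    using le f unfolding Feq by force
  ultimately show ?thesis
    using a that[of "- a"] by simp
qed

section \<open>Facets indexed by the rows of the ray matrix\<close>

locale labelled_polytope =
  fixes P :: "(real^'d) set" and U :: "real^'d^'n"
  assumes simple: "simple_polytope P"
    and full: "aff_dim P = int CARD('d)"
    and card_facets: "card {F. F facet_of P} = CARD('n)"
    and ray_matrix: "ray_matrix_of U (normal_fan P)"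
begin

text \<open>The facet dual to ray \<open>i\<close>. Taking minimizers of row \<open>i\<close> avoids
  choosing a facet and is insensitive to positive rescaling of the row.\<close>

definition wall :: "'n \<Rightarrow> (real^'d) set" where
  "wall i = {z\<in>P. \<forall>y\<in>P. U $ i \<bullet> z \<le> U $ i \<bullet> y}"

lemma polytope: "polytope P" and polyhedron: "polyhedron P"
  using simple polytope_imp_polyhedron by (auto simp: simple_polytope_def)

lemma convex: "convex P"
  using polyhedron polyhedron_imp_convex by blast

lemma facet_normal:
  assumes "F facet_of P"
  obtains u where "u \<noteq> 0" "normal_cone P F = conic hull {u}"
    "F = {z\<in>P. \<forall>y\<in>P. u \<bullet> z \<le> u \<bullet> y}"
  using normal_cone_facet[OF polyhedron _ assms] full by auto

lemma minimizers_conic_hull: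
  assumes "conic hull {u} = conic hull {w}" "u \<noteq> 0"
  shows "{z\<in>P. \<forall>y\<in>P. u \<bullet> z \<le> u \<bullet> y} = {z\<in>P. \<forall>y\<in>P. w \<bullet> z \<le> w \<bullet> y}"
proof -
  have "u \<in> conic hull {w}"
    using assms(1) hull_inc[of u "{u}" conic] by simp
  then obtain c where c: "c \<ge> 0" "u = c *\<^sub>R w"
    by (auto simp: mem_conic_hull_singleton)
  then have "c > 0" using assms(2) by (cases "c = 0") auto
  then show ?thesis by (simp add: c(2))
qed

lemma inj_on_normal_cone_facets: "inj_on (normal_cone P) {F. F facet_of P}"
proof (rule inj_onI, clarsimp)
  fix F G assume FG: "F facet_of P" "G facet_of P" "normal_cone P F = normal_cone P G"
  obtain u where u: "u \<noteq> 0" "normal_cone P F = conic hull {u}"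
    "F = {z\<in>P. \<forall>y\<in>P. u \<bullet> z \<le> u \<bullet> y}" using facet_normal[OF FG(1)] .
  obtain w where w: "w \<noteq> 0" "normal_cone P G = conic hull {w}"
    "G = {z\<in>P. \<forall>y\<in>P. w \<bullet> z \<le> w \<bullet> y}" using facet_normal[OF FG(2)] .
  show "F = G"
    using minimizers_conic_hull[of u w] u w FG(3) by metis
qed

lemma inj_ray: "inj (ray U)"
  using ray_matrix by (auto simp: ray_matrix_of_def bij_betw_def)

text \<open>A counting argument: the normal cones of facets are \<open>CARD('n)\<close> distinct
  one-dimensional cones of the fan, and the labelling allows exactly that many.\<close>

lemma range_ray: "range (ray U) = normal_cone P ` {F. F facet_of P}"
proof -
  have cones: "range (ray U) = cones_of_dim 1 (normal_fan P)"
    using ray_matrix by (auto simp: ray_matrix_of_def bij_betw_def)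
  have "normal_cone P ` {F. F facet_of P} \<subseteq> cones_of_dim 1 (normal_fan P)"
  proof (clarsimp simp: cones_of_dim_def)
    fix F assume F: "F facet_of P"
    obtain u where "u \<noteq> 0" "normal_cone P F = conic hull {u}"
      using facet_normal[OF F] by metis
    then show "normal_cone P F \<in> normal_fan P \<and> aff_dim (normal_cone P F) = 1"
      using F aff_dim_ray[of u] by (auto simp: normal_fan_def facet_of_def)
  qed
  moreover have "card (normal_cone P ` {F. F facet_of P}) = card (range (ray U))"
    using card_image[OF inj_on_normal_cone_facets] card_image[OF inj_ray] card_facets by simp
  ultimately show ?thesis
    using cones card_subset_eq[of "range (ray U)"] by (metis finite finite_imageI)
qed

lemma wall_facet_normal_cone: "wall i facet_of P \<and> normal_cone P (wall i) = ray U i"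
proof -
  obtain F where F: "F facet_of P" "normal_cone P F = ray U i"
    using range_ray by (metis (mono_tags, lifting) image_iff mem_Collect_eq rangeI)
  obtain u where u: "u \<noteq> 0" "normal_cone P F = conic hull {u}"
    "F = {z\<in>P. \<forall>y\<in>P. u \<bullet> z \<le> u \<bullet> y}" using facet_normal[OF F(1)] .
  have "F = wall i"
    using minimizers_conic_hull[of u "U $ i"] u F(2) unfolding wall_def ray_def by metis
  then show ?thesis using F by simp
qed

lemmas wall_facet = wall_facet_normal_cone[THEN conjunct1]
  and normal_cone_wall = wall_facet_normal_cone[THEN conjunct2]

lemma inj_wall: "inj wall"
  by (rule injI) (metis normal_cone_wall inj_ray injD)

lemma facets_eq_walls: "{F. F facet_of P} = range wall"
proof -
  have "F \<in> range wall" if F: "F facet_of P" for F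
  proof -
    obtain i where "normal_cone P F = ray U i"
      using range_ray F by (metis (mono_tags, lifting) imageE imageI mem_Collect_eq)
    then have "F = wall i"
      using inj_onD[OF inj_on_normal_cone_facets, of F "wall i"] F
      by (simp add: normal_cone_wall wall_facet)
    then show ?thesis by simp
  qed
  then show ?thesis using wall_facet by auto
qed

lemma wall_face: "wall i face_of P"
  using wall_facet by (rule facet_of_imp_face_of)

lemma mem_wall_iff:
  assumes "p \<in> wall i" "z \<in> P"
  shows "z \<in> wall i \<longleftrightarrow> U $ i \<bullet> z = U $ i \<bullet> p"
  using assms unfolding wall_def by (smt (verit) mem_Collect_eq)

lemma wall_nonempty: "wall i \<noteq> {}"
  using wall_facet by (simp add: facet_of_def)

lemma mem_normal_cone_iff:
  assumes "G \<subseteq> P"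
  shows "U $ i \<in> normal_cone P G \<longleftrightarrow> G \<subseteq> wall i"
  using assms by (auto simp: normal_cone_def wall_def)

text \<open>Links the fan to incidences: \<open>\<sigma>_G(1)\<close> is the set of facets
  containing \<open>G\<close>. The harder inclusion shows that the normal cone of a facet through
  \<open>G\<close> is a face of the normal cone of \<open>G\<close>.\<close>

lemma rays_of_normal_cone:
  assumes G: "G face_of P" "G \<noteq> {}"
  shows "rays_of_cone U (normal_cone P G) = {i. G \<subseteq> wall i}"
proof (intro subset_antisym subsetI; simp add: rays_of_cone_def)
  have GP: "G \<subseteq> P" using G(1) face_of_imp_subset by blast
  fix i
  {
    assume "ray U i face_of normal_cone P G"
    then have "U $ i \<in> normal_cone P G"
      using face_of_imp_subset hull_inc[of "U $ i" "{U $ i}"] by (auto simp: ray_def)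
    then show "G \<subseteq> wall i" by (simp add: mem_normal_cone_iff[OF GP])
  }
  assume i: "G \<subseteq> wall i"
  obtain g where g: "g \<in> G" using G(2) by auto
  have "normal_cone P (wall i) face_of normal_cone P G"
    unfolding face_of_def
  proof (intro conjI ballI impI)
    show "normal_cone P (wall i) \<subseteq> normal_cone P G"
      using i by (auto simp: normal_cone_def)
    show "convex (normal_cone P (wall i))"
      by (simp add: normal_cone_wall ray_def convex_conic_hull)
    fix a b x assume a: "a \<in> normal_cone P G" and b: "b \<in> normal_cone P G"
      and x: "x \<in> normal_cone P (wall i)" "x \<in> open_segment a b"
    \<comment> \<open>Both \<open>a\<close> and \<open>b\<close> are minimal at \<open>g\<close>,
      while the positive combination \<open>x\<close> is constant on the facet; two nonnegative
      differences with positive weights and sum zero both vanish.\<close>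
    have *: "a \<bullet> y = a \<bullet> g \<and> b \<bullet> y = b \<bullet> g" if y: "y \<in> wall i" for y
    proof -
      have yP: "y \<in> P" and gw: "g \<in> wall i" and gP: "g \<in> P"
        using y g i GP by (auto simp: wall_def)
      obtain t where t: "0 < t" "t < 1" "x = (1 - t) *\<^sub>R a + t *\<^sub>R b"
        using x(2) by (auto simp: in_segment)
      have "a \<bullet> g \<le> a \<bullet> y" "b \<bullet> g \<le> b \<bullet> y"
        using a b g yP by (auto simp: normal_cone_def)
      moreover have "x \<bullet> y = x \<bullet> g"
        using x(1) y gw yP gP by (auto simp: normal_cone_def intro!: antisym)
      then have "(1 - t) * (a \<bullet> y - a \<bullet> g) + t * (b \<bullet> y - b \<bullet> g) = 0"
        by (simp add: t(3) inner_add_left algebra_simps)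
      ultimately show ?thesis
        using t(1,2) add_nonneg_eq_0_iff[of "(1 - t) * (a \<bullet> y - a \<bullet> g)" "t * (b \<bullet> y - b \<bullet> g)"]
        by (auto simp: zero_le_mult_iff)
    qed
    show "a \<in> normal_cone P (wall i)" "b \<in> normal_cone P (wall i)"
      using * a b g by (auto simp: normal_cone_def)
  qed
  then show "ray U i face_of normal_cone P G"
    by (simp add: normal_cone_wall)
qed

end

section \<open>Facet inequalities, dimensions of faces and simplicity\<close>

lemma dim_orthogonal_vectors:
  fixes X :: "'a::euclidean_space set"
  shows "dim {w. \<forall>x\<in>X. x \<bullet> w = 0} + dim X = DIM('a)"
proof -
  have "{w. \<forall>x\<in>X. x \<bullet> w = 0} = {w \<in> UNIV. \<forall>x\<in>span X. orthogonal x w}"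
    by (auto simp: orthogonal_def span_base)
       (metis orthogonal_commute orthogonal_def orthogonal_to_span)
  then show ?thesis
    using dim_subspace_orthogonal_to_vectors[of "span X" UNIV] by simp
qed

context labelled_polytope
begin

text \<open>The right-hand side of the facet inequality of row \<open>i\<close>; the chosen point is
  immaterial because the row is constant on its facet.\<close>

definition level :: "'n \<Rightarrow> real" where
  "level i = U $ i \<bullet> (SOME y. y \<in> wall i)"

lemma some_mem_wall: "(SOME y. y \<in> wall i) \<in> wall i"
  using wall_nonempty by (simp add: some_in_eq)

lemma level_le: "x \<in> P \<Longrightarrow> level i \<le> U $ i \<bullet> x"
  using some_mem_wall[of i] by (simp add: level_def wall_def)

lemma wall_eq: "wall i = {x\<in>P. U $ i \<bullet> x = level i}"
proof -
  have "x \<in> P" if "x \<in> wall i" for x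
    using that by (simp add: wall_def)
  then show ?thesis
    using mem_wall_iff[OF some_mem_wall[of i]] unfolding level_def by blast
qed

text \<open>A segment from an interior point to a point outside \<open>P\<close> crosses the
  boundary on some facet. There the inequality would be strict, because it is strict at the interior
  point and weak at the other end.\<close>

lemma mem_iff_level_le: "x \<in> P \<longleftrightarrow> (\<forall>i. level i \<le> U $ i \<bullet> x)"
proof
  assume x: "\<forall>i. level i \<le> U $ i \<bullet> x"
  show "x \<in> P"
  proof (rule ccontr)
    assume xP: "x \<notin> P"
    have int: "rel_interior P = interior P" "interior P \<noteq> {}"
      using full aff_dim_eq_full[of P] convex rel_interior_interior[of P]
        rel_interior_eq_empty[of P] by auto
    obtain p where p: "p \<in> interior P" using int by auto
    have "closed_segment p x \<inter> frontier P \<noteq> {}"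
      by (rule connected_Int_frontier) (use p xP interior_subset in auto)
    then obtain y where y: "y \<in> closed_segment p x" "y \<in> frontier P" by auto
    have "closed P" using polyhedron by (rule polyhedron_imp_closed)
    then have "y \<in> P - interior P"
      using y(2) by (auto simp: frontier_def)
    then have yP: "y \<in> P" and "y \<in> \<Union> {F. F facet_of P}"
      using rel_boundary_of_polyhedron[OF polyhedron] int(1) by auto
    then obtain i where i: "y \<in> wall i" by (auto simp: facets_eq_walls)
    have "p \<notin> wall i"
      using rel_boundary_of_polyhedron[OF polyhedron] int(1) p wall_facet by blast
    then have pi: "level i < U $ i \<bullet> p"
      using level_le[of p i] p interior_subset[of P] unfolding wall_eq by fastforce
    obtain t where t: "0 \<le> t" "t \<le> 1" "y = (1 - t) *\<^sub>R p + t *\<^sub>R x"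
      using y(1) by (auto simp: in_segment)
    have "t \<noteq> 1" using t(3) yP xP by auto
    then have "0 < (1 - t) * (U $ i \<bullet> p - level i)" using t pi by simp
    moreover have "0 \<le> t * (U $ i \<bullet> x - level i)" using t x by simp
    ultimately have "level i < U $ i \<bullet> y"
      by (simp add: t(3) inner_add_right algebra_simps)
    then show False using i by (simp add: wall_eq)
  qed
qed (simp add: level_le)

text \<open>For a nonempty face \<open>G\<close> this is \<open>\<sigma>_G(1)\<close>, by
  \<open>rays_of_normal_cone\<close>.\<close>

definition tight :: "(real^'d) set \<Rightarrow> 'n set" where
  "tight G = {i. G \<subseteq> wall i}"

lemma facets_with: "{F. F facet_of P \<and> Q F} = wall ` {i. Q (wall i)}"
proof -
  have "{F. F facet_of P \<and> Q F} = {F \<in> range wall. Q F}"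
    unfolding facets_eq_walls[symmetric] by simp
  then show ?thesis by auto
qed

lemma tight_antimono: "G \<subseteq> H \<Longrightarrow> tight H \<subseteq> tight G"
  by (auto simp: tight_def)

lemma mem_face_iff:
  assumes G: "G face_of P" "G \<noteq> {}"
  shows "x \<in> G \<longleftrightarrow> x \<in> P \<and> (\<forall>i\<in>tight G. x \<in> wall i)"
proof (cases "G = P")
  case True
  then show ?thesis by (auto simp: tight_def)
next
  case False
  have "G = \<Inter> {F. F facet_of P \<and> G \<subseteq> F}"
    by (rule face_of_polyhedron[OF polyhedron G False])
  also have "{F. F facet_of P \<and> G \<subseteq> F} = wall ` tight G"
    by (simp add: facets_with tight_def)
  finally have "G = \<Inter> (wall ` tight G)" .
  then have "x \<in> G \<longleftrightarrow> (\<forall>i\<in>tight G. x \<in> wall i)"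
    by (metis INT_iff)
  then show ?thesis
    using face_of_imp_subset[OF G(1)] by (metis subsetD)
qed

text \<open>Near a relative interior point \<open>g\<close> all inequalities outside
  \<open>tight G\<close> are strict, so \<open>G\<close> agrees there with the translate by
  \<open>g\<close> of the solution space \<open>D\<close> of the tight equations.\<close>

lemma aff_dim_face:
  assumes G: "G face_of P" "G \<noteq> {}"
  shows "aff_dim G = int (dim {w. \<forall>i\<in>tight G. U $ i \<bullet> w = 0})"
proof -
  define D where "D = {w. \<forall>i\<in>tight G. U $ i \<bullet> w = 0}"
  have GP: "G \<subseteq> P" using G(1) by (rule face_of_imp_subset)
  have D: "subspace D"
    by (auto simp: D_def subspace_def inner_add_right)
  have "convex G" using G(1) by (rule face_of_imp_convex)
  then obtain g where g: "g \<in> rel_interior G"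
    using G(2) rel_interior_eq_empty by blast
  have gG: "g \<in> G" using g rel_interior_subset by blast
  have slack: "level i < U $ i \<bullet> g" if "i \<notin> tight G" for i
  proof -
    have "g \<notin> wall i"
      using subset_of_face_of[OF wall_face GP, of i] g that by (auto simp: tight_def)
    then show ?thesis
      using level_le[of g i] gG GP by (force simp: wall_eq)
  qed
  define T where "T = (\<Inter>i\<in>- tight G. {x. level i < U $ i \<bullet> x})"
  have T: "open T"
    unfolding T_def by (intro open_INT) (auto simp: open_halfspace_gt)
  have dimD: "aff_dim ((+) g ` D) = int (dim D)"
    by (simp add: aff_dim_translation_eq aff_dim_subspace[OF D])
  have tight_eq: "U $ i \<bullet> x = level i" if "x \<in> G" "i \<in> tight G" for i x
    using that by (auto simp: tight_def wall_eq)
  have "G \<subseteq> (+) g ` D"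
  proof
    fix x assume "x \<in> G"
    then have "x - g \<in> D"
      using tight_eq gG by (simp add: D_def inner_diff_right)
    then show "x \<in> (+) g ` D" by (rule image_eqI[rotated]) simp
  qed
  then have 1: "aff_dim G \<le> int (dim D)"
    using aff_dim_subset dimD by metis
  have "(+) g ` D \<inter> T \<subseteq> G"
  proof
    fix x assume "x \<in> (+) g ` D \<inter> T"
    then obtain w where w: "w \<in> D" "x = g + w" "x \<in> T" by auto
    have eq: "U $ i \<bullet> x = level i" if "i \<in> tight G" for i
      using that w(1) tight_eq[OF gG that] by (simp add: w(2) D_def inner_add_right)
    have "level i \<le> U $ i \<bullet> x" for i
      using eq w(3) by (cases "i \<in> tight G") (auto simp: T_def less_imp_le)
    then have "x \<in> P" by (simp add: mem_iff_level_le)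
    then show "x \<in> G"
      using eq by (simp add: mem_face_iff[OF G] wall_eq)
  qed
  then have "aff_dim ((+) g ` D \<inter> T) \<le> aff_dim G" by (rule aff_dim_subset)
  moreover have "aff_dim ((+) g ` D \<inter> T) = aff_dim ((+) g ` D)"
  proof (rule aff_dim_convex_Int_open[OF _ T])
    show "convex ((+) g ` D)" using D by (simp add: subspace_imp_convex)
    have "g \<in> (+) g ` D \<inter> T"
      using slack subspace_0[OF D] by (auto simp: T_def image_iff)
    then show "(+) g ` D \<inter> T \<noteq> {}" by blast
  qed
  ultimately show ?thesis
    using 1 dimD unfolding D_def by linarith
qed

lemma inj_row: "inj (($) U)"
  by (rule injI) (metis inj_ray injD ray_def)

lemma tight_vertex: "tight {v} = {i. v \<in> wall i}"
  by (auto simp: tight_def)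

lemma card_tight_vertex:
  assumes "v extreme_point_of P"
  shows "card (tight {v}) = CARD('d)"
proof -
  have "{F. F facet_of P \<and> v \<in> F} = wall ` tight {v}"
    by (simp add: facets_with tight_vertex)
  then have "card (tight {v}) = card {F. F facet_of P \<and> v \<in> F}"
    using card_image[of wall "tight {v}"] inj_wall inj_on_subset by fastforce
  then show ?thesis
    using simple assms full by (simp add: simple_polytope_def)
qed

lemma dim_tight_vertex:
  assumes v: "v extreme_point_of P"
  shows "dim (($) U ` tight {v}) = CARD('d)"
proof -
  have "{v} face_of P" using v by (simp add: face_of_singleton)
  from aff_dim_face[OF this] have "dim {w. \<forall>i\<in>tight {v}. U $ i \<bullet> w = 0} = 0" by simp
  then show ?thesis
    using dim_orthogonal_vectors[of "($) U ` tight {v}"] by (simp del: dim_eq_0)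
qed

text \<open>Simplicity makes the number of tight rows equal to their rank
  \<open>CARD('d)\<close>.\<close>

lemma independent_tight_vertex:
  assumes v: "v extreme_point_of P"
  shows "independent (($) U ` tight {v})"
proof (rule card_le_dim_spanning[of _ "($) U ` tight {v}"])
  show "card (($) U ` tight {v}) \<le> dim (($) U ` tight {v})"
    using card_image_le[of "tight {v}" "($) U"]
    by (simp add: dim_tight_vertex[OF v] card_tight_vertex[OF v])
qed (simp_all add: span_superset)

text \<open>The tight rows span, so \<open>w\<close> is orthogonal to itself. This kernel form of
  nonsingularity is the assumption \<open>ker\<close> of the later lemmas on minors and
  chambers.\<close>

lemma vertex_kernel:
  assumes v: "v extreme_point_of P" and w: "\<And>i. i \<in> tight {v} \<Longrightarrow> U $ i \<bullet> w = 0"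
  shows "w = 0"
proof -
  have "span (($) U ` tight {v}) = UNIV"
    using dim_tight_vertex[OF v] dim_eq_full[of "($) U ` tight {v}"] by simp
  moreover have "orthogonal w x" if "x \<in> ($) U ` tight {v}" for x
  proof -
    obtain i where "i \<in> tight {v}" "x = U $ i" using \<open>x \<in> _\<close> by blast
    then show ?thesis by (simp add: orthogonal_def inner_commute[of w "U $ i"] w)
  qed
  ultimately have "orthogonal w w"
    using orthogonal_to_span[of w "($) U ` tight {v}" w] by blast
  then show ?thesis by (simp add: orthogonal_def)
qed

text \<open>The rows tight on \<open>G\<close> are among the independent rows tight at a vertex of
  \<open>G\<close>, so their number is their rank and \<open>aff_dim_face\<close> applies.\<close>

lemma card_tight:
  assumes G: "G face_of P" "G \<noteq> {}"
  shows "int (card (tight G)) = int CARD('d) - aff_dim G"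
proof -
  have "compact G" "convex G"
    using face_of_polytope_polytope[OF polytope G(1)]
    by (auto intro: polytope_imp_compact polytope_imp_convex)
  then obtain v where v: "v extreme_point_of G"
    using G(2) by (rule extreme_point_exists_convex)
  then have vP: "v extreme_point_of P" and "v \<in> G"
    using extreme_point_of_face[OF G(1)] by auto
  then have "independent (($) U ` tight G)"
    using independent_mono[OF independent_tight_vertex[OF vP]] tight_antimono[of "{v}" G]
    by (simp add: image_mono)
  then have "dim (($) U ` tight G) = card (tight G)"
    using dim_eq_card_independent card_image[of "($) U" "tight G"] inj_row inj_on_subset
    by (metis subset_UNIV)
  then show ?thesis
    using aff_dim_face[OF G] dim_orthogonal_vectors[of "($) U ` tight G"] by simp
qed

lemma aff_dim_normal_cone_vertex:
  assumes v: "v extreme_point_of P"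
  shows "aff_dim (normal_cone P {v}) = int CARD('d)"
proof -
  have vP: "v \<in> P" using v by (simp add: extreme_point_of_def)
  have "($) U ` tight {v} \<subseteq> normal_cone P {v}"
    using mem_normal_cone_iff[of "{v}"] vP by (auto simp: tight_def)
  then have "dim (normal_cone P {v}) \<ge> CARD('d)"
    using dim_subset dim_tight_vertex[OF v] by metis
  moreover have "dim (normal_cone P {v}) \<le> CARD('d)"
    using dim_subset_UNIV[of "normal_cone P {v}"] by simp
  moreover have "0 \<in> normal_cone P {v}" by (simp add: normal_cone_def)
  ultimately show ?thesis by (simp add: aff_dim_zero hull_inc)
qed

text \<open>Two distinct points of a face confine its normal cone to the hyperplane orthogonal to
  their difference, so full-dimensional cones belong to vertices.\<close>

lemma maximal_cones:
  "cones_of_dim CARD('d) (normal_fan P) = (\<lambda>v. normal_cone P {v}) ` {v. v extreme_point_of P}"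
proof (intro subset_antisym subsetI)
  fix \<sigma> assume "\<sigma> \<in> cones_of_dim CARD('d) (normal_fan P)"
  then obtain G where G: "\<sigma> = normal_cone P G" "G face_of P" "G \<noteq> {}"
    and dim: "aff_dim \<sigma> = int CARD('d)"
    by (auto simp: cones_of_dim_def normal_fan_def)
  obtain v where v: "v \<in> G" using G(3) by auto
  have "y = v" if y: "y \<in> G" for y
  proof (rule ccontr)
    assume "y \<noteq> v"
    have "\<sigma> \<subseteq> {u. (y - v) \<bullet> u = 0}"
    proof
      fix u assume "u \<in> \<sigma>"
      then have "u \<bullet> y \<le> u \<bullet> v" "u \<bullet> v \<le> u \<bullet> y"
        using G(1) y v face_of_imp_subset[OF G(2)] by (auto simp: normal_cone_def)
      then show "u \<in> {u. (y - v) \<bullet> u = 0}"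
        by (simp add: inner_commute[of _ u] inner_diff_right)
    qed
    then have "aff_dim \<sigma> \<le> aff_dim {u. (y - v) \<bullet> u = 0}" by (rule aff_dim_subset)
    then show False using dim \<open>y \<noteq> v\<close> by simp
  qed
  then have "G = {v}" using v by blast
  then show "\<sigma> \<in> (\<lambda>v. normal_cone P {v}) ` {v. v extreme_point_of P}"
    using G by (auto simp: face_of_singleton)
next
  fix \<sigma> assume "\<sigma> \<in> (\<lambda>v. normal_cone P {v}) ` {v. v extreme_point_of P}"
  then show "\<sigma> \<in> cones_of_dim CARD('d) (normal_fan P)"
    using aff_dim_normal_cone_vertex
    by (auto simp: cones_of_dim_def normal_fan_def face_of_singleton)
qed

lemma rays_of_vertex_cone:
  assumes "v extreme_point_of P"
  shows "rays_of_cone U (normal_cone P {v}) = tight {v}"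
  using rays_of_normal_cone[of "{v}"] assms by (auto simp: face_of_singleton tight_def)

lemma neighbours_eq: "neighbours P U \<Delta> = {i. (wall i \<inter> \<Delta>) facet_of \<Delta>}"
proof -
  have "F = wall i" if "F facet_of P" "normal_cone P F = ray U i" for F i
    using that inj_onD[OF inj_on_normal_cone_facets, of F "wall i"]
    by (simp add: normal_cone_wall wall_facet)
  then show ?thesis
    using wall_facet normal_cone_wall unfolding neighbours_def by blast
qed

end

section \<open>Simplex faces\<close>

text \<open>\<open>C\<close> is the vertex set of the simplex; its size \<open>d - k + 1\<close> is
  stated additively to avoid truncated subtraction.\<close>

locale simplex_face = labelled_polytope P U
  for P :: "(real^'d) set" and U :: "real^'d^'n" +
  fixes \<Delta> :: "(real^'d) set" and C :: "(real^'d) set" and k :: nat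
  assumes face: "\<Delta> face_of P"
    and affine_independent: "\<not> affine_dependent C"
    and card_vertices: "card C + k = CARD('d) + 1"
    and k_less: "k < CARD('d)"
    and \<Delta>_eq: "\<Delta> = convex hull C"
begin

lemma finite_C: "finite C"
  using affine_independent by (rule aff_independent_finite)

lemma C_subset: "C \<subseteq> \<Delta>"
  by (simp add: \<Delta>_eq hull_subset)

lemma \<Delta>_nonempty: "\<Delta> \<noteq> {}"
  using card_vertices k_less by (auto simp: \<Delta>_eq)

lemma vertex_iff: "v \<in> C \<longleftrightarrow> v extreme_point_of P \<and> v \<in> \<Delta>"
  using extreme_point_of_face[OF face, of v]
    extreme_point_of_convex_hull_affine_independent[OF affine_independent, of v]
  by (simp add: \<Delta>_eq)

lemma aff_dim_\<Delta>: "aff_dim \<Delta> = int CARD('d) - int k"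
  using aff_dim_affine_independent[OF affine_independent] card_vertices
  by (simp add: \<Delta>_eq aff_dim_convex_hull)

lemma card_tight_\<Delta>: "card (tight \<Delta>) = k"
  using card_tight[OF face \<Delta>_nonempty] aff_dim_\<Delta> by simp

lemma opposite_facet:
  assumes v: "v \<in> C"
  shows "convex hull (C - {v}) facet_of \<Delta>" "card (tight (convex hull (C - {v}))) = Suc k"
    "v \<notin> convex hull (C - {v})"
proof -
  have "card (C - {v}) = card C - 1" using v finite_C by simp
  then have "card (C - {v}) \<noteq> 0" using card_vertices k_less by linarith
  then have "C - {v} \<noteq> {}" by (metis card.empty)
  then show facet: "convex hull (C - {v}) facet_of \<Delta>"
    using facet_of_convex_hull_affine_independent[OF affine_independent, of "convex hull (C - {v})"] v
    unfolding \<Delta>_eq by auto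
  then have "convex hull (C - {v}) face_of P" "convex hull (C - {v}) \<noteq> {}"
    "aff_dim (convex hull (C - {v})) = aff_dim \<Delta> - 1"
    using face face_of_trans by (auto simp: facet_of_def)
  then show "card (tight (convex hull (C - {v}))) = Suc k"
    using card_tight[of "convex hull (C - {v})"] aff_dim_\<Delta> by simp
  show "v \<notin> convex hull (C - {v})"
    using affine_independent v convex_hull_subset_affine_hull unfolding affine_dependent_def by blast
qed

text \<open>The ray of the facet of \<open>P\<close> that cuts out the facet of \<open>\<Delta>\<close> opposite to \<open>v\<close>.\<close>

definition nbr :: "real^'d \<Rightarrow> 'n" where
  "nbr v = (THE i. tight (convex hull (C - {v})) = insert i (tight \<Delta>) \<and> i \<notin> tight \<Delta>)"

text \<open>By \<open>card_tight\<close>, passing from \<open>\<Delta>\<close> to the facet opposite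
  to \<open>v\<close> raises the number of tight rows from \<open>k\<close> to \<open>k + 1\<close>,
  so exactly one row is new and the description in \<open>nbr_def\<close> is unique.\<close>

lemma nbr:
  assumes v: "v \<in> C"
  shows "tight (convex hull (C - {v})) = insert (nbr v) (tight \<Delta>)" "nbr v \<notin> tight \<Delta>"
proof -
  have sub: "tight \<Delta> \<subseteq> tight (convex hull (C - {v}))"
    by (rule tight_antimono) (simp add: \<Delta>_eq hull_mono)
  have "card (tight (convex hull (C - {v})) - tight \<Delta>) = 1"
    using opposite_facet(2)[OF v] card_tight_\<Delta> card_Diff_subset[OF _ sub] by simp
  then obtain i where "tight (convex hull (C - {v})) - tight \<Delta> = {i}"
    by (auto simp: card_1_singleton_iff)
  then have "\<exists>!i. tight (convex hull (C - {v})) = insert i (tight \<Delta>) \<and> i \<notin> tight \<Delta>"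
    using sub by (intro ex1I[of _ i]) auto
  from theI'[OF this, folded nbr_def]
  show "tight (convex hull (C - {v})) = insert (nbr v) (tight \<Delta>)" "nbr v \<notin> tight \<Delta>" by auto
qed

lemma wall_Int_proper:
  assumes "i \<notin> tight \<Delta>"
  shows "wall i \<inter> \<Delta> face_of \<Delta>" "wall i \<inter> \<Delta> \<noteq> \<Delta>"
proof -
  have "wall i \<inter> \<Delta> face_of P" using wall_face face by (rule face_of_Int)
  then show "wall i \<inter> \<Delta> face_of \<Delta>"
    using face_of_face[OF face] by auto
  show "wall i \<inter> \<Delta> \<noteq> \<Delta>" using assms by (auto simp: tight_def)
qed

text \<open>The intersection is a proper face of \<open>\<Delta>\<close> containing the opposite
  facet as a face; codimension one leaves no room for a strict inclusion.\<close>

lemma wall_nbr: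
  assumes v: "v \<in> C"
  shows "wall (nbr v) \<inter> \<Delta> = convex hull (C - {v})"
proof -
  have "convex hull (C - {v}) \<subseteq> wall (nbr v) \<inter> \<Delta>"
    using nbr(1)[OF v] by (auto simp: tight_def \<Delta>_eq intro: hull_mono[THEN subsetD])
  moreover have "convex hull (C - {v}) face_of wall (nbr v) \<inter> \<Delta>"
    using opposite_facet(1)[OF v] calculation(1)
    by (meson facet_of_imp_face_of face_of_subset inf_le2)
  then have "aff_dim (convex hull (C - {v})) < aff_dim (wall (nbr v) \<inter> \<Delta>)
      \<or> wall (nbr v) \<inter> \<Delta> = convex hull (C - {v})"
    using face_of_aff_dim_lt wall_Int_proper(1)[OF nbr(2)[OF v]] face_of_imp_convex by metis
  moreover have "aff_dim (wall (nbr v) \<inter> \<Delta>) < aff_dim \<Delta>"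
    using face_of_aff_dim_lt[OF face_of_imp_convex[OF face] wall_Int_proper[OF nbr(2)[OF v]]] .
  ultimately show ?thesis
    using opposite_facet(1)[OF v] by (auto simp: facet_of_def)
qed

lemma neighbours_eq_nbr: "neighbours P U \<Delta> = nbr ` C"
proof (intro subset_antisym subsetI)
  fix i assume "i \<in> neighbours P U \<Delta>"
  then have facet: "wall i \<inter> \<Delta> facet_of \<Delta>" by (simp add: neighbours_eq)
  then obtain v where v: "v \<in> C" "wall i \<inter> \<Delta> = convex hull (C - {v})"
    using facet_of_convex_hull_affine_independent[OF affine_independent] unfolding \<Delta>_eq by auto
  have "i \<in> tight (convex hull (C - {v}))"
    using v(2) by (auto simp: tight_def)
  moreover have "i \<notin> tight \<Delta>"
    using facet v(2) by (auto simp: tight_def facet_of_def Int_absorb1)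
  ultimately have "i = nbr v" using nbr(1)[OF v(1)] by auto
  then show "i \<in> nbr ` C" using v by auto
next
  fix i assume "i \<in> nbr ` C"
  then show "i \<in> neighbours P U \<Delta>"
    using wall_nbr opposite_facet(1) by (auto simp: neighbours_eq)
qed

lemma inj_on_nbr: "inj_on nbr C"
proof (rule inj_onI, rule ccontr)
  fix v w assume vw: "v \<in> C" "w \<in> C" "nbr v = nbr w" "v \<noteq> w"
  then have "v \<in> convex hull (C - {w})" by (simp add: hull_inc)
  then show False
    using wall_nbr[OF vw(1)] wall_nbr[OF vw(2)] vw(3) opposite_facet(3)[OF vw(1)] by simp
qed

lemma rays_of_\<Delta>: "rays_of_cone U (normal_cone P \<Delta>) = tight \<Delta>"
  using rays_of_normal_cone[OF face \<Delta>_nonempty] by (simp add: tight_def)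

lemma disjoint_nbr: "nbr ` C \<inter> tight \<Delta> = {}"
  using nbr(2) by auto

lemma card_support: "card (nbr ` C \<union> tight \<Delta>) = CARD('d) + 1"
  using card_Un_disjoint[OF _ _ disjoint_nbr] finite_C card_image[OF inj_on_nbr]
    card_tight_\<Delta> card_vertices by simp

text \<open>Both sides have \<open>CARD('d)\<close> elements, so the inclusion from right to left
  suffices: \<open>v\<close> lies on every facet of \<open>\<Delta>\<close> except the one opposite
  to it.\<close>

lemma tight_vertex_eq:
  assumes v: "v \<in> C"
  shows "tight {v} = nbr ` C \<union> tight \<Delta> - {nbr v}"
proof -
  have "v extreme_point_of P" "v \<in> \<Delta>" using v vertex_iff by auto
  then have "card (tight {v}) = CARD('d)" using card_tight_vertex by blast
  moreover have "nbr ` C \<union> tight \<Delta> - {nbr v} \<subseteq> tight {v}"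
  proof
    fix i assume i: "i \<in> nbr ` C \<union> tight \<Delta> - {nbr v}"
    show "i \<in> tight {v}"
    proof (cases "i \<in> tight \<Delta>")
      case True
      then show ?thesis using tight_antimono[of "{v}" \<Delta>] \<open>v \<in> \<Delta>\<close> by auto
    next
      case False
      then obtain w where w: "w \<in> C" "i = nbr w" "w \<noteq> v" using i by auto
      then have "v \<in> convex hull (C - {w})" using v by (simp add: hull_inc)
      then have "v \<in> wall (nbr w)" using wall_nbr[OF w(1)] by auto
      then show ?thesis by (simp add: w(2) tight_vertex)
    qed
  qed
  moreover have "card (nbr ` C \<union> tight \<Delta> - {nbr v}) = CARD('d)"
    using card_support v by (subst card_Diff_singleton) auto
  ultimately show ?thesis
    using card_subset_eq[of "tight {v}" "nbr ` C \<union> tight \<Delta> - {nbr v}"] by simp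
qed

lemma tight_subset_vertexD:
  assumes "v extreme_point_of P" "tight \<Delta> \<subseteq> tight {v}"
  shows "v \<in> C"
proof -
  have "v \<in> P" using assms(1) by (simp add: extreme_point_of_def)
  then have "v \<in> \<Delta>"
    using assms(2) mem_face_iff[OF face \<Delta>_nonempty, of v] by (auto simp: tight_vertex)
  then show ?thesis using assms(1) vertex_iff by simp
qed

end

section \<open>Circuits and minors\<close>

lemma sum_eq_sum_support:
  fixes f :: "'n::finite \<Rightarrow> 'a::comm_monoid_add"
  assumes "\<And>i. i \<notin> R \<Longrightarrow> f i = 0"
  shows "sum f UNIV = sum f R"
  using assms by (intro sum.mono_neutral_right) auto

lemma basis_rows_right_inverse:
  fixes U :: "real^'d^'n"
  assumes B: "card B = CARD('d)"
    and ker: "\<And>w. (\<And>i. i \<in> B \<Longrightarrow> U $ i \<bullet> w = 0) \<Longrightarrow> w = 0"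
  obtains e :: "'d \<Rightarrow> 'n" and X where "bij_betw e UNIV B" "(\<chi> j. U $ e j) ** X = mat 1"
proof -
  obtain e :: "'d \<Rightarrow> 'n" where e: "bij_betw e UNIV B"
    using finite_same_card_bij[of "UNIV :: 'd set" B] B by auto
  define M where "M = (\<chi> j. U $ e j)"
  have "w = 0" if "M *v w = 0" for w
  proof (rule ker)
    fix i assume "i \<in> B"
    then obtain j where "i = e j" using e by (auto simp: bij_betw_def)
    then show "U $ i \<bullet> w = 0"
      using arg_cong[OF that, of "\<lambda>x. x $ j"] by (simp add: M_def matrix_vector_mul_component)
  qed
  then have "\<exists>X. X ** M = mat 1"
    by (simp add: matrix_left_invertible_ker)
  then show ?thesis
    using that[OF e] matrix_left_right_inverse[of M] by (auto simp: M_def)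
qed

text \<open>Expand row \<open>i0\<close> in the basis of rows \<open>B\<close>, normalised by
  \<open>c i0 = 1\<close>. By Cramer's rule, exchanging a basis row for row \<open>i0\<close>
  multiplies the determinant by the corresponding coordinate.\<close>

lemma circuit_relation:
  fixes U :: "real^'d^'n"
  assumes B: "card B = CARD('d)" and i0: "i0 \<notin> B"
    and ker: "\<And>w. (\<And>i. i \<in> B \<Longrightarrow> U $ i \<bullet> w = 0) \<Longrightarrow> w = 0"
  obtains c :: "'n \<Rightarrow> real" where
    "\<And>i. i \<notin> insert i0 B \<Longrightarrow> c i = 0" "c i0 = 1" "(\<Sum>i\<in>UNIV. c i *\<^sub>R U $ i) = 0"
    "\<And>i. i \<in> insert i0 B \<Longrightarrow> \<bar>row_minor U (insert i0 B - {i})\<bar> = \<bar>c i\<bar> * \<bar>row_minor U B\<bar>"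
proof -
  obtain e :: "'d \<Rightarrow> 'n" and X where e: "bij_betw e UNIV B" and X: "(\<chi> j. U $ e j) ** X = mat 1"
    using basis_rows_right_inverse[OF B ker] .
  define M where "M = (\<chi> j. U $ e j)"
  have "X ** M = mat 1"
    unfolding M_def by (rule matrix_left_right_inverse[THEN iffD1, OF X])
  then have "\<exists>Y. transpose M ** Y = mat 1"
    unfolding right_invertible_transpose by blast
  then obtain a where a: "transpose M *v a = U $ i0"
    unfolding matrix_right_invertible_surjective by (metis surjD)
  have Ui0: "U $ i0 = (\<Sum>j\<in>UNIV. a $ j *s row j M)"
    unfolding a[symmetric] matrix_mult_sum by simp
  define g where "g = inv_into UNIV e"
  have g: "g (e j) = j" for j
    using e by (simp add: g_def bij_betw_def)
  define c where "c = (\<lambda>i. if i = i0 then 1 else if i \<in> B then - (a $ g i) else 0)"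
  have eB: "e j \<in> B" and ei0: "e j \<noteq> i0" for j
    using e i0 by (auto simp: bij_betw_def)
  have ce: "c (e j) = - (a $ j)" for j
    using eB ei0 by (simp add: c_def g)
  have "(\<Sum>i\<in>UNIV. c i *\<^sub>R U $ i) = (\<Sum>i\<in>insert i0 B. c i *\<^sub>R U $ i)"
    by (rule sum_eq_sum_support) (simp add: c_def)
  also have "\<dots> = U $ i0 + (\<Sum>i\<in>B. c i *\<^sub>R U $ i)"
    using i0 by (simp add: c_def)
  also have "(\<Sum>i\<in>B. c i *\<^sub>R U $ i) = (\<Sum>j\<in>UNIV. c (e j) *\<^sub>R U $ e j)"
    by (rule sum.reindex_bij_betw[OF e, symmetric])
  also have "\<dots> = - U $ i0"
    by (simp add: ce Ui0 row_def M_def sum_negf scalar_mult_eq_scaleR vec_nth_inverse)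
  finally have rel: "(\<Sum>i\<in>UNIV. c i *\<^sub>R U $ i) = 0" by simp
  have minor: "\<bar>row_minor U (insert i0 B - {i})\<bar> = \<bar>c i\<bar> * \<bar>row_minor U B\<bar>"
    if i: "i \<in> insert i0 B" for i
  proof (cases "i = i0")
    case True
    then show ?thesis using i0 by (simp add: c_def)
  next
    case False
    then obtain k where k: "i = e k" using i e by (auto simp: bij_betw_def)
    \<comment> \<open>This enumeration puts \<open>i0\<close> in the position of the removed row,
      the shape needed by \<open>cramer_lemma_transpose\<close>.\<close>
    have "bij_betw (e(k := i0)) UNIV (insert i0 B - {i})"
    proof -
      have "inj e" "range e = B" using e by (auto simp: bij_betw_def)
      then show ?thesis
        using ei0 False unfolding bij_betw_def k
        by (auto simp: inj_on_def image_def split: if_splits) metis+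
    qed
    from row_minor_up_to_sign[OF this, of U]
    have "\<bar>row_minor U (insert i0 B - {i})\<bar> = \<bar>det (\<chi> j. U $ ((e(k := i0)) j))\<bar>"
      by auto
    also have "(\<chi> j. U $ ((e(k := i0)) j)) =
        (\<chi> j. if j = k then (\<Sum>j\<in>UNIV. a $ j *s row j M) else row j M)"
      unfolding Ui0[symmetric] by (auto simp: vec_eq_iff row_def M_def)
    also have "det \<dots> = a $ k * det M"
      by (rule cramer_lemma_transpose)
    finally show ?thesis
      using row_minor_up_to_sign[OF e, of U] by (auto simp: M_def[symmetric] k ce abs_mult)
  qed
  show ?thesis
    by (rule that[of c]) (use rel minor in \<open>auto simp: c_def\<close>)
qed

lemma det_zero_iff_kernel:
  fixes A :: "'a::field^'n^'n"
  shows "det A = 0 \<longleftrightarrow> (\<exists>y. y \<noteq> 0 \<and> A *v y = 0)"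
  using invertible_det_nz[of A] invertible_left_inverse[of A] matrix_left_invertible_ker[of A]
  by blast

text \<open>Singularity is tested by kernels, avoiding a Laplace expansion: a right kernel vector
  paired with the relation gives the form, and conversely \<open>c\<close> itself is a left kernel
  vector.\<close>

lemma row_minor_augmented_zero_iff:
  fixes U :: "real^'d^'n" and c :: "'n \<Rightarrow> real"
  assumes B: "card B = CARD('d)" and i0: "i0 \<notin> B"
    and ker: "\<And>w. (\<And>i. i \<in> B \<Longrightarrow> U $ i \<bullet> w = 0) \<Longrightarrow> w = 0"
    and c: "\<And>i. i \<notin> insert i0 B \<Longrightarrow> c i = 0" "c i0 \<noteq> 0"
    and rel: "(\<Sum>i\<in>UNIV. c i *\<^sub>R U $ i) = 0"
  shows "row_minor (augmented U x) (insert i0 B) = 0 \<longleftrightarrow> (\<Sum>i\<in>UNIV. of_real (c i) * x $ i) = 0"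
proof -
  have "card (UNIV :: 'd option set) = card (insert i0 B)"
    using B i0 by simp
  then obtain e :: "'d option \<Rightarrow> 'n" where e: "bij_betw e UNIV (insert i0 B)"
    using finite_same_card_bij[of "UNIV :: 'd option set" "insert i0 B"] by auto
  define A where "A = (\<chi> j. augmented U x $ e j)"
  have minor: "row_minor (augmented U x) (insert i0 B) = 0 \<longleftrightarrow> det A = 0"
    using row_minor_up_to_sign[OF e, of "augmented U x"] by (auto simp: A_def)
  have rel': "(\<Sum>i\<in>UNIV. complex_of_real (c i) * of_real (U $ i $ l)) = 0" for l
  proof -
    have "(\<Sum>i\<in>UNIV. c i * U $ i $ l) = 0"
      using arg_cong[OF rel, of "\<lambda>v. v $ l"] by simp
    then have "complex_of_real (\<Sum>i\<in>UNIV. c i * U $ i $ l) = 0" by simp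
    then show ?thesis by simp
  qed
  have row: "(A *v y) $ j = x $ e j * y $ None + (\<Sum>l\<in>UNIV. of_real (U $ e j $ l) * y $ Some l)"
    for y j
    by (simp add: A_def augmented_def matrix_vector_mult_def UNIV_option_conv sum.reindex)
  show ?thesis
    unfolding minor
  proof
    assume "det A = 0"
    then obtain y where y: "y \<noteq> 0" "A *v y = 0"
      by (auto simp: det_zero_iff_kernel)
    have eq: "x $ i * y $ None + (\<Sum>l\<in>UNIV. of_real (U $ i $ l) * y $ Some l) = 0"
      if "i \<in> insert i0 B" for i
    proof -
      have "i \<in> range e" using that bij_betw_imp_surj_on[OF e] by simp
      then obtain j where "i = e j" by blast
      then show ?thesis using row[of y j] y(2) by simp
    qed
    \<comment> \<open>Otherwise the rows in \<open>B\<close> annihilate the remaining coordinates of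
      \<open>y\<close>. These rows are real, so \<open>ker\<close> applies separately to real and
      imaginary parts.\<close>
    have "y $ None \<noteq> 0"
    proof
      assume y0: "y $ None = 0"
      have *: "(\<Sum>l\<in>UNIV. complex_of_real (U $ i $ l) * y $ Some l) = 0" if "i \<in> B" for i
        using eq[of i] that y0 by simp
      have "(\<chi> l. Re (y $ Some l)) = 0"
      proof (rule ker)
        fix i assume "i \<in> B"
        from arg_cong[OF *[OF this], of Re]
        show "U $ i \<bullet> (\<chi> l. Re (y $ Some l)) = 0"
          by (simp add: inner_vec_def)
      qed
      moreover have "(\<chi> l. Im (y $ Some l)) = 0"
      proof (rule ker)
        fix i assume "i \<in> B"
        from arg_cong[OF *[OF this], of Im]
        show "U $ i \<bullet> (\<chi> l. Im (y $ Some l)) = 0"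
          by (simp add: inner_vec_def)
      qed
      ultimately have "y $ Some l = 0" for l
        by (simp add: vec_eq_iff complex_eq_iff)
      then have "y $ j = 0" for j using y0 by (cases j) auto
      then show False using y(1) by (simp add: vec_eq_iff)
    qed
    \<comment> \<open>Weight the kernel equations by \<open>c\<close>; the columns of
      \<open>U\<close> cancel by the relation, leaving the form times
      \<open>y $ None\<close>.\<close>
    have "0 = (\<Sum>i\<in>UNIV. of_real (c i) *
        (x $ i * y $ None + (\<Sum>l\<in>UNIV. of_real (U $ i $ l) * y $ Some l)))"
      using eq c(1) by (intro sum.neutral[symmetric]) auto
    also have "\<dots> = (\<Sum>i\<in>UNIV. of_real (c i) * x $ i) * y $ None
        + (\<Sum>i\<in>UNIV. \<Sum>l\<in>UNIV. of_real (c i) * of_real (U $ i $ l) * y $ Some l)"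
      by (simp add: algebra_simps sum.distrib sum_distrib_left sum_distrib_right)
    also have "(\<Sum>i\<in>UNIV. \<Sum>l\<in>UNIV. complex_of_real (c i) * of_real (U $ i $ l) * y $ Some l)
        = (\<Sum>l\<in>UNIV. (\<Sum>i\<in>UNIV. of_real (c i) * of_real (U $ i $ l)) * y $ Some l)"
      by (subst sum.swap) (simp add: sum_distrib_right)
    finally show "(\<Sum>i\<in>UNIV. of_real (c i) * x $ i) = 0"
      using \<open>y $ None \<noteq> 0\<close> by (simp add: rel')
  next
    assume x: "(\<Sum>i\<in>UNIV. of_real (c i) * x $ i) = 0"
    define z :: "complex^('d option)" where "z = (\<chi> j. of_real (c (e j)))"
    have reindex: "(\<Sum>j\<in>UNIV. of_real (c (e j)) * f (e j)) = (\<Sum>i\<in>UNIV. of_real (c i) * f i)"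
      for f :: "'n \<Rightarrow> complex"
    proof -
      have "(\<Sum>i\<in>UNIV. of_real (c i) * f i) = (\<Sum>i\<in>insert i0 B. of_real (c i) * f i)"
        by (rule sum_eq_sum_support) (simp add: c(1))
      then show ?thesis
        using sum.reindex_bij_betw[OF e, of "\<lambda>i. of_real (c i) * f i"] by simp
    qed
    have "(transpose A *v z) $ m = 0" for m
    proof (cases m)
      case None
      then show ?thesis
        using x reindex[of "\<lambda>i. x $ i"]
        by (simp add: A_def z_def augmented_def transpose_def matrix_vector_mult_def mult.commute)
    next
      case (Some l)
      then show ?thesis
        using rel'[of l] reindex[of "\<lambda>i. of_real (U $ i $ l)"]
        by (simp add: A_def z_def augmented_def transpose_def matrix_vector_mult_def mult.commute)
    qed
    then have "transpose A *v z = 0" by (simp add: vec_eq_iff)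
    moreover have "z \<noteq> 0"
    proof -
      obtain j where "e j = i0" using e by (metis bij_betw_imp_surj_on imageE insertI1)
      then have "z $ j \<noteq> 0" using c(2) by (simp add: z_def)
      then show ?thesis by auto
    qed
    ultimately have "det (transpose A) = 0"
      unfolding det_zero_iff_kernel by blast
    then show "det A = 0" by simp
  qed
qed

text \<open>The map \<open>\<phi>\<close> corrects coordinate \<open>i0\<close> so that the form
  vanishes. It carries \<open>V0\<close>, where the coordinates in \<open>insert i0 S\<close> are
  zero, bijectively onto the solution space.\<close>

lemma vec_dim_coordinates_and_form:
  fixes c :: "'n::finite \<Rightarrow> 'a::field" and S :: "'n::finite set"
  assumes i0: "i0 \<notin> S" "c i0 \<noteq> 0"
  shows "vec.dim {x::'a^'n. (\<Sum>i\<in>UNIV. c i * x $ i) = 0 \<and> (\<forall>i\<in>S. x $ i = 0)} + card S + 1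
    = CARD('n)"
proof -
  define V where "V = {x::'a^'n. (\<Sum>i\<in>UNIV. c i * x $ i) = 0 \<and> (\<forall>i\<in>S. x $ i = 0)}"
  define V0 where "V0 = {x::'a^'n. \<forall>i. i \<notin> - insert i0 S \<longrightarrow> x $ i = 0}"
  define \<phi> where "\<phi> = (\<lambda>x::'a^'n. x - axis i0 ((\<Sum>i\<in>UNIV. c i * x $ i) / c i0))"
  have lin: "Vector_Spaces.linear (*s) (*s) \<phi>"
    by unfold_locales
       (auto simp: \<phi>_def vec_eq_iff axis_def algebra_simps sum.distrib sum_distrib_left
         add_divide_distrib)
  have span: "vec.span V0 = V0"
    unfolding vec.span_eq_iff by (auto simp: V0_def vec.subspace_def)
  have \<phi>_nth: "\<phi> x $ i = x $ i" if "i \<noteq> i0" for x i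
    using that by (simp add: \<phi>_def axis_def)
  have "inj_on \<phi> V0"
  proof (rule inj_onI)
    fix x y assume xy: "x \<in> V0" "y \<in> V0" "\<phi> x = \<phi> y"
    have "x $ i = y $ i" for i
    proof (cases "i = i0")
      case True
      then show ?thesis using xy(1,2) by (simp add: V0_def)
    next
      case False
      then show ?thesis using \<phi>_nth xy(3) by metis
    qed
    then show "x = y" by (simp add: vec_eq_iff)
  qed
  then have dim: "vec.dim (\<phi> ` V0) = vec.dim V0"
    using vec.dim_image_eq[OF lin, of V0] by (simp add: span)
  have form: "(\<Sum>i\<in>UNIV. c i * \<phi> x $ i) = 0" for x
  proof -
    have "(\<Sum>i\<in>UNIV. c i * \<phi> x $ i) =
        (\<Sum>i\<in>UNIV. c i * x $ i) - (\<Sum>i\<in>UNIV. c i * axis i0 ((\<Sum>i\<in>UNIV. c i * x $ i) / c i0) $ i)"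
      by (simp add: \<phi>_def algebra_simps sum_subtractf)
    also have "(\<Sum>i\<in>UNIV. c i * axis i0 ((\<Sum>i\<in>UNIV. c i * x $ i) / c i0) $ i) = (\<Sum>i\<in>UNIV. c i * x $ i)"
      using i0(2) by (simp add: axis_def if_distrib[of "\<lambda>t. _ * t"] cong: if_cong)
    finally show ?thesis by simp
  qed
  have "\<phi> ` V0 = V"
  proof (intro subset_antisym subsetI)
    fix y assume "y \<in> \<phi> ` V0"
    then obtain x where x: "x \<in> V0" "y = \<phi> x" by auto
    have "y $ i = 0" if "i \<in> S" for i
      using that i0(1) x \<phi>_nth[of i x] by (auto simp: V0_def)
    then show "y \<in> V" using form x(2) by (simp add: V_def)
  next
    fix y assume y: "y \<in> V"
    define x where "x = y - axis i0 (y $ i0)"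
    have "x \<in> V0" using y by (auto simp: V0_def V_def x_def axis_def)
    moreover have "\<phi> x = y"
    proof -
      have "(\<Sum>i\<in>UNIV. c i * x $ i) = (\<Sum>i\<in>UNIV. c i * y $ i) - c i0 * y $ i0"
        by (simp add: x_def axis_def algebra_simps sum_subtractf if_distrib[of "\<lambda>t. _ * t"] cong: if_cong)
      then have "(\<Sum>i\<in>UNIV. c i * x $ i) / c i0 = - y $ i0"
        using y i0(2) by (simp add: V_def)
      then show ?thesis by (simp add: \<phi>_def x_def vec_eq_iff axis_def)
    qed
    ultimately show "y \<in> \<phi> ` V0" by blast
  qed
  moreover have "vec.dim V0 = card (- insert i0 S)"
    unfolding V0_def by (rule dim_substandard_cart)
  moreover have "card (- insert i0 S) = CARD('n) - Suc (card S)"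
    using i0(1) by (simp add: Compl_eq_Diff_UNIV card_Diff_subset)
  moreover have "Suc (card S) \<le> CARD('n)"
    using card_mono[of UNIV "insert i0 S"] i0(1) by simp
  ultimately show ?thesis using dim by (simp add: V_def)
qed

section \<open>The circuit and the adjoint of a simplex face\<close>

context simplex_face
begin

definition support :: "'n set" where
  "support = nbr ` C \<union> tight \<Delta>"

lemma nbr_slope:
  assumes v: "v \<in> C" and w: "w \<in> C" "w \<noteq> v"
  shows "0 < U $ nbr v \<bullet> (v - w)"
proof -
  have "v \<notin> wall (nbr v)"
    using opposite_facet(3)[OF v] wall_nbr[OF v] C_subset v by blast
  moreover have "w \<in> wall (nbr v)"
    using w wall_nbr[OF v] hull_inc[of w "C - {v}" convex] by blast
  moreover have "v \<in> P" using v C_subset face_of_imp_subset[OF face] by blast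
  ultimately show ?thesis
    using level_le[of v "nbr v"] by (auto simp: wall_eq inner_diff_right)
qed

text \<open>The circuit is built from the basis at one vertex \<open>v0\<close>, so \<open>m\<close>
  is the absolute minor at \<open>v0\<close>. Positive coefficients at all neighbours remove the
  absolute values, making the minors proportional to \<open>c\<close> itself.\<close>

lemma vertex_relation:
  obtains c :: "'n \<Rightarrow> real" and m :: real where
    "\<And>i. i \<notin> support \<Longrightarrow> c i = 0"
    "(\<Sum>i\<in>UNIV. c i *\<^sub>R U $ i) = 0"
    "\<And>v. v \<in> C \<Longrightarrow> 0 < c (nbr v)"
    "\<And>v. v \<in> C \<Longrightarrow> \<bar>row_minor U (tight {v})\<bar> = m * c (nbr v)"
    "\<And>x. W P U \<Delta> x = 0 \<longleftrightarrow> (\<Sum>i\<in>UNIV. of_real (c i) * x $ i) = 0"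
proof -
  obtain v0 where v0: "v0 \<in> C"
    using \<Delta>_nonempty by (auto simp: \<Delta>_eq)
  define B where "B = tight {v0}"
  have B: "B = support - {nbr v0}" and supp: "support = insert (nbr v0) B"
    using tight_vertex_eq[OF v0] v0 by (auto simp: B_def support_def)
  have vP: "v0 extreme_point_of P" using v0 vertex_iff by simp
  have cardB: "card B = CARD('d)" unfolding B_def by (rule card_tight_vertex[OF vP])
  have ker: "w = 0" if "\<And>i. i \<in> B \<Longrightarrow> U $ i \<bullet> w = 0" for w
    using vertex_kernel[OF vP] that by (simp add: B_def)
  have notin: "nbr v0 \<notin> B" by (simp add: B)
  obtain c where c: "\<And>i. i \<notin> support \<Longrightarrow> c i = 0" "c (nbr v0) = 1"
    "(\<Sum>i\<in>UNIV. c i *\<^sub>R U $ i) = 0"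
    "\<And>i. i \<in> support \<Longrightarrow> \<bar>row_minor U (support - {i})\<bar> = \<bar>c i\<bar> * \<bar>row_minor U B\<bar>"
    using circuit_relation[OF cardB notin ker] unfolding supp[symmetric] by blast
  have pos: "0 < c (nbr v)" if v: "v \<in> C" for v
  proof (cases "v = v0")
    case True
    then show ?thesis using c(2) by simp
  next
    case False
    have ne: "nbr v \<noteq> nbr v0" using inj_onD[OF inj_on_nbr] v v0 False by blast
    have "0 = (\<Sum>i\<in>UNIV. c i *\<^sub>R U $ i) \<bullet> (v - v0)" by (simp add: c(3))
    also have "\<dots> = (\<Sum>i\<in>UNIV. c i * (U $ i \<bullet> (v - v0)))" by (simp add: inner_sum_left)
    \<comment> \<open>All other rows of the circuit are tight at both ends of the edge and vanish on
      its direction.\<close>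
    also have "\<dots> = (\<Sum>i\<in>{nbr v, nbr v0}. c i * (U $ i \<bullet> (v - v0)))"
    proof (rule sum_eq_sum_support)
      fix i assume i: "i \<notin> {nbr v, nbr v0}"
      show "c i * (U $ i \<bullet> (v - v0)) = 0"
      proof (cases "i \<in> support")
        case True
        then have "i \<in> tight {v}" "i \<in> tight {v0}"
          using i tight_vertex_eq v v0 by (auto simp: support_def)
        then show ?thesis by (auto simp: tight_vertex wall_eq inner_diff_right)
      qed (simp add: c(1))
    qed
    also have "\<dots> = c (nbr v) * (U $ nbr v \<bullet> (v - v0)) - U $ nbr v0 \<bullet> (v0 - v)"
      using ne c(2) by (simp add: inner_diff_right)
    finally have "c (nbr v) * (U $ nbr v \<bullet> (v - v0)) > 0"
      using nbr_slope[OF v0 v False] by simp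
    then show ?thesis
      using nbr_slope[OF v v0] False by (auto simp: zero_less_mult_iff)
  qed
  have minor: "\<bar>row_minor U (tight {v})\<bar> = \<bar>row_minor U B\<bar> * c (nbr v)" if v: "v \<in> C" for v
    using c(4)[of "nbr v"] pos[OF v] v tight_vertex_eq[OF v] by (simp add: support_def)
  have "W P U \<Delta> x = 0 \<longleftrightarrow> (\<Sum>i\<in>UNIV. of_real (c i) * x $ i) = 0" for x
    unfolding W_def rays_of_\<Delta> neighbours_eq_nbr support_def[symmetric] unfolding supp
    by (rule row_minor_augmented_zero_iff[OF cardB notin ker]) (use c in \<open>auto simp: supp\<close>)
  with c(1,3) pos minor show ?thesis by (rule that)
qed

lemma tight_vertex_inj:
  assumes "v extreme_point_of P" "w extreme_point_of P" "tight {v} = tight {w}"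
  shows "v = w"
proof -
  have "U $ i \<bullet> (v - w) = 0" if "i \<in> tight {v}" for i
  proof -
    have "i \<in> tight {w}" using that assms(3) by simp
    then show ?thesis using that by (simp add: tight_vertex wall_eq inner_diff_right)
  qed
  from vertex_kernel[OF assms(1) this] show ?thesis by simp
qed

text \<open>A vertex outside \<open>\<Delta>\<close> misses some facet containing
  \<open>\<Delta>\<close>, so its monomial has a zero factor. The monomial of a vertex
  \<open>v\<close> of \<open>\<Delta>\<close> is \<open>x $ nbr v\<close> times a factor common to
  all of \<open>C\<close>.\<close>

lemma Adj_on_face:
  assumes x: "\<And>i. i \<in> tight \<Delta> \<Longrightarrow> x $ i = 0"
  shows "Adj (normal_fan P) U x =
    (\<Sum>v\<in>C. of_real \<bar>row_minor U (tight {v})\<bar> * x $ nbr v) * (\<Prod>i\<in>- support. x $ i)"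
proof -
  let ?V = "{v. v extreme_point_of P}"
  let ?t = "\<lambda>v. of_real \<bar>row_minor U (tight {v})\<bar> * (\<Prod>i\<in>- tight {v}. x $ i)"
  have inj: "inj_on (\<lambda>v. normal_cone P {v}) ?V"
  proof (rule inj_onI, clarify)
    fix v w assume vw: "v extreme_point_of P" "w extreme_point_of P"
      and eq: "normal_cone P {v} = normal_cone P {w}"
    have "tight {v} = tight {w}"
      using arg_cong[OF eq, of "rays_of_cone U"] vw by (simp add: rays_of_vertex_cone)
    with vw show "v = w" by (rule tight_vertex_inj)
  qed
  \<comment> \<open>Vertices are finite in number because they inject into subsets of the finite
    index type.\<close>
  have "inj_on (\<lambda>v. tight {v}) ?V"
    by (rule inj_onI) (simp add: tight_vertex_inj)
  then have fin: "finite ?V"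
    by (rule inj_on_finite[of _ _ UNIV]) auto
  have "Adj (normal_fan P) U x = (\<Sum>v\<in>?V. ?t v)"
    unfolding Adj_def maximal_cones sum.reindex[OF inj]
    by (rule sum.cong) (simp_all add: rays_of_vertex_cone)
  also have "\<dots> = (\<Sum>v\<in>C. ?t v)"
  proof (rule sum.mono_neutral_right[OF fin])
    show "C \<subseteq> ?V" using vertex_iff by auto
    show "\<forall>v\<in>?V - C. ?t v = 0"
    proof
      fix v assume "v \<in> ?V - C"
      then obtain i where "i \<in> tight \<Delta>" "i \<notin> tight {v}"
        using tight_subset_vertexD by blast
      then have "(\<Prod>i\<in>- tight {v}. x $ i) = 0"
        using x by (intro prod_zero) auto
      then show "?t v = 0" by simp
    qed
  qed
  also have "\<dots> = (\<Sum>v\<in>C. of_real \<bar>row_minor U (tight {v})\<bar> * x $ nbr v * (\<Prod>i\<in>- support. x $ i))"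
  proof (rule sum.cong)
    fix v assume v: "v \<in> C"
    have "- tight {v} = insert (nbr v) (- support)"
      using tight_vertex_eq[OF v] by (auto simp: support_def)
    moreover have "nbr v \<in> support" using v by (simp add: support_def)
    ultimately show "?t v = of_real \<bar>row_minor U (tight {v})\<bar> * x $ nbr v * (\<Prod>i\<in>- support. x $ i)"
      by simp
  qed simp
  finally show ?thesis by (simp add: sum_distrib_right)
qed

end

section \<open>Chambers and Zariski density\<close>

lemma convex_cone_sum_mem:
  assumes "convex_cone K" "\<And>i. i \<in> A \<Longrightarrow> f i \<in> K"
  shows "sum f A \<in> K"
  using assms(2)
  by (induction A rule: infinite_finite_induct)
     (auto simp: convex_cone_contains_0[OF assms(1)] convex_cone_add[OF assms(1)])

text \<open>Makes the cones \<open>C_I\<close> finitely generated, hence polyhedral and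
  closed.\<close>

lemma span_eq_convex_cone_hull:
  fixes S :: "'a::real_vector set"
  assumes "finite S"
  shows "span S = convex_cone hull (S \<union> uminus ` S)"
proof
  show "convex_cone hull (S \<union> uminus ` S) \<subseteq> span S"
    by (rule hull_minimal) (auto simp: convex_cone_span span_base span_neg)
  show "span S \<subseteq> convex_cone hull (S \<union> uminus ` S)"
  proof
    fix x assume "x \<in> span S"
    then obtain u where u: "x = (\<Sum>v\<in>S. u v *\<^sub>R v)"
      unfolding span_finite[OF assms] by auto
    have "u v *\<^sub>R v \<in> convex_cone hull (S \<union> uminus ` S)" if "v \<in> S" for v
    proof (cases "u v \<ge> 0")
      case True
      then show ?thesis
        using that by (intro convex_cone_scaleR[OF convex_cone_convex_cone_hull]) (auto simp: hull_inc)
    next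
      case False
      then have "(- u v) *\<^sub>R (- v) \<in> convex_cone hull (S \<union> uminus ` S)"
        using that by (intro convex_cone_scaleR[OF convex_cone_convex_cone_hull]) (auto simp: hull_inc)
      then show ?thesis by simp
    qed
    then show "x \<in> convex_cone hull (S \<union> uminus ` S)"
      unfolding u by (rule convex_cone_sum_mem[OF convex_cone_convex_cone_hull])
  qed
qed

lemma closed_chamber_cone: "closed (chamber_cone U I)"
proof -
  let ?c = "columns U"
  have fin: "finite ?c"
  proof -
    have "?c = range (\<lambda>j. column j U)" by (auto simp: columns_def)
    then show ?thesis by simp
  qed
  have "chamber_cone U I = convex_cone hull ((\<lambda>i. axis i 1) ` I \<union> (?c \<union> uminus ` ?c))"
    unfolding chamber_cone_def coordinate_cone_def span_eq_convex_cone_hull[OF fin]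
      convex_cone_hull_Un[of "(\<lambda>i. axis i 1) ` I"] by blast
  then show ?thesis
    using fin by (simp add: polyhedron_imp_closed polyhedron_convex_cone_hull)
qed

text \<open>Treat the closed sets one at a time: if the current piece is not contained in
  \<open>S\<close>, removing \<open>S\<close> leaves a nonempty relatively open piece.\<close>

lemma openin_decide_closed_family:
  assumes "finite \<C>" "\<And>S. S \<in> \<C> \<Longrightarrow> closed S" "openin (top_of_set H) N" "N \<noteq> {}"
  shows "\<exists>N'. openin (top_of_set H) N' \<and> N' \<noteq> {} \<and> N' \<subseteq> N \<and> (\<forall>S\<in>\<C>. N' \<subseteq> S \<or> N' \<inter> S = {})"
  using assms(1,2)
proof (induction \<C> rule: finite_induct)
  case empty
  then show ?case using assms(3,4) by blast
next
  case (insert S \<C>)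
  then obtain N' where N': "openin (top_of_set H) N'" "N' \<noteq> {}" "N' \<subseteq> N"
    "\<forall>S\<in>\<C>. N' \<subseteq> S \<or> N' \<inter> S = {}" by auto
  show ?case
  proof (cases "N' \<subseteq> S")
    case True
    then show ?thesis using N' by auto
  next
    case False
    have "openin (top_of_set H) (N' \<inter> - S)"
      using N'(1) insert.prems by (intro openin_Int_open) auto
    then show ?thesis
      using N' False by (intro exI[of _ "N' \<inter> - S"]) blast
  qed
qed

lemma coordinate_cone_nonneg:
  fixes z :: "real^'n"
  assumes "\<And>i. 0 \<le> z $ i" "\<And>i. i \<notin> J \<Longrightarrow> z $ i = 0"
  shows "z \<in> coordinate_cone J"
proof -
  have "z = (\<Sum>i\<in>UNIV. z $ i *s axis i 1)"
    by (simp add: basis_expansion)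
  also have "\<dots> = (\<Sum>i\<in>J. z $ i *\<^sub>R axis i 1)"
    using assms(2) by (subst sum.mono_neutral_right[of UNIV J]) (auto simp: scalar_mult_eq_scaleR)
  also have "\<dots> \<in> coordinate_cone J"
    unfolding coordinate_cone_def
    by (intro convex_cone_sum_mem[OF convex_cone_convex_cone_hull]
          convex_cone_scaleR[OF convex_cone_convex_cone_hull])
       (auto simp: assms(1) hull_inc)
  finally show ?thesis .
qed

lemma subspace_linear_form: "subspace {y::real^'n. (\<Sum>i\<in>UNIV. c i * y $ i) = 0}"
  by (auto simp: subspace_def algebra_simps sum.distrib sum_distrib_left[symmetric])

text \<open>The form vanishes on the columns of \<open>U\<close> by the relation, and on the
  generators indexed by \<open>J\<close> because \<open>c\<close> is zero there.\<close>

lemma chamber_cone_subset: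
  fixes U :: "real^'d^'n"
  assumes rel: "(\<Sum>i\<in>UNIV. c i *\<^sub>R U $ i) = 0" and c: "\<And>i. i \<in> J \<Longrightarrow> c i = 0"
  shows "chamber_cone U J \<subseteq> {y. (\<Sum>i\<in>UNIV. c i * y $ i) = 0}" (is "_ \<subseteq> ?H")
proof -
  have H: "subspace ?H" by (rule subspace_linear_form)
  have "coordinate_cone J \<subseteq> ?H"
    unfolding coordinate_cone_def
    by (rule hull_minimal)
       (auto simp: H subspace_imp_convex_cone axis_def c if_distrib[of "\<lambda>t. _ * t"] cong: if_cong)
  moreover have "span (columns U) \<subseteq> ?H"
  proof (rule span_minimal[OF _ H], clarsimp simp: columns_def)
    fix l
    show "(\<Sum>i\<in>UNIV. c i * column l U $ i) = 0"
      using arg_cong[OF rel, of "\<lambda>v. v $ l"] by (simp add: column_def)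
  qed
  ultimately show ?thesis
    unfolding chamber_cone_def using subspace_add[OF H] by blast
qed

text \<open>Modulo the column space, a point of the hyperplane \<open>c \<bullet> y = 0\<close> is determined by its
  coordinates outside the circuit \<open>insert i0 B\<close>; they are positive near the sum of the corresponding
  basis vectors.\<close>

lemma chamber_cone_contains_open:
  fixes U :: "real^'d^'n"
  assumes B: "card B = CARD('d)" and i0: "i0 \<notin> B" "c i0 \<noteq> 0"
    and ker: "\<And>w. (\<And>i. i \<in> B \<Longrightarrow> U $ i \<bullet> w = 0) \<Longrightarrow> w = 0"
    and c: "\<And>i. i \<notin> insert i0 B \<Longrightarrow> c i = 0"
    and rel: "(\<Sum>i\<in>UNIV. c i *\<^sub>R U $ i) = 0"
  obtains N where "openin (top_of_set {y::real^'n. (\<Sum>i\<in>UNIV. c i * y $ i) = 0}) N" "N \<noteq> {}"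
    "N \<subseteq> chamber_cone U (- insert i0 B)"
proof -
  let ?J = "- insert i0 B"
  let ?H = "{y::real^'n. (\<Sum>i\<in>UNIV. c i * y $ i) = 0}"
  obtain e :: "'d \<Rightarrow> 'n" and X where e: "bij_betw e UNIV B" and X: "(\<chi> j. U $ e j) ** X = mat 1"
    using basis_rows_right_inverse[OF B ker] .
  define M where "M = (\<chi> j. U $ e j)"
  \<comment> \<open>Subtracts the unique vector of the column space that agrees with
    \<open>y\<close> on the coordinates in \<open>B\<close>.\<close>
  define r where "r = (\<lambda>y::real^'n. y - U *v (X *v (\<chi> j. y $ e j)))"
  have lin: "linear r"
  proof -
    have "linear (\<lambda>y::real^'n. \<chi> j. y $ e j)"
      by (rule linearI) (simp_all add: vec_eq_iff)
    then have "linear ((*v) U \<circ> ((*v) X \<circ> (\<lambda>y::real^'n. \<chi> j. y $ e j)))"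
      by (intro linear_compose) auto
    then show ?thesis
      unfolding r_def using linear_compose_sub[OF linear_ident] by (simp add: o_def)
  qed
  have cols: "U *v w \<in> span (columns U)" for w
    by (rule matrix_vector_mult_in_columnspace)
  have "span (columns U) \<subseteq> chamber_cone U {}"
    unfolding chamber_cone_def coordinate_cone_def by auto
  then have UH: "U *v w \<in> ?H" for w
    using chamber_cone_subset[OF rel, of "{}"] cols by blast
  have rB: "r y $ i = 0" if "i \<in> B" for y i
  proof -
    have "i \<in> range e" using that bij_betw_imp_surj_on[OF e] by simp
    then obtain j where j: "i = e j" by blast
    have "(U *v (X *v (\<chi> j. y $ e j))) $ e j = (M *v (X *v (\<chi> j. y $ e j))) $ j"
      by (simp add: M_def matrix_vector_mul_component)
    also have "\<dots> = y $ e j"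
      by (simp add: matrix_vector_mul_assoc M_def X)
    finally show ?thesis by (simp add: r_def j)
  qed
  \<comment> \<open>On the hyperplane, once the coordinates in \<open>B\<close> are zero, only the
    term at \<open>i0\<close> is left in the form.\<close>
  have ri0: "r y $ i0 = 0" if y: "y \<in> ?H" for y
  proof -
    have "r y \<in> ?H"
      unfolding r_def using subspace_diff[OF subspace_linear_form y UH] .
    then have "(\<Sum>i\<in>UNIV. c i * r y $ i) = 0" by simp
    moreover have "(\<Sum>i\<in>UNIV. c i * r y $ i) = (\<Sum>i\<in>{i0}. c i * r y $ i)"
      using rB c by (intro sum.mono_neutral_right) auto
    ultimately show ?thesis using i0(2) by simp
  qed
  define N where "N = ?H \<inter> (\<Inter>i\<in>?J. {y. 0 < r y $ i})"
  have "open (\<Inter>i\<in>?J. {y. 0 < r y $ i})"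
  proof (intro open_INT ballI)
    fix i
    show "open {y. 0 < r y $ i}"
      by (intro open_Collect_less continuous_intros linear_continuous_on
            linear_conv_bounded_linear[THEN iffD1] lin)
  qed simp
  then have "openin (top_of_set ?H) N"
    unfolding N_def by (simp add: openin_open_Int)
  moreover have "(\<chi> i. if i \<in> ?J then 1 else 0) \<in> N"
  proof -
    let ?y = "(\<chi> i. if i \<in> ?J then 1 else 0) :: real^'n"
    have "e j \<in> B" for j using e by (auto simp: bij_betw_def)
    then have "(\<chi> j. ?y $ e j) = 0" by (simp add: vec_eq_iff)
    then have "r ?y = ?y" by (simp add: r_def)
    moreover have "?y \<in> ?H"
      using c by (auto intro!: sum.neutral)
    ultimately show ?thesis by (simp add: N_def)
  qed
  moreover have "N \<subseteq> chamber_cone U ?J"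
  proof
    fix y assume y: "y \<in> N"
    have "r y \<in> coordinate_cone ?J"
    proof (rule coordinate_cone_nonneg)
      have yH: "y \<in> ?H" using y by (simp add: N_def)
      show "r y $ i = 0" if "i \<notin> ?J" for i
        using that rB ri0[OF yH] by auto
      then show "0 \<le> r y $ i" for i
        using y by (cases "i \<in> ?J") (auto simp: N_def less_imp_le)
    qed
    moreover have "y = r y + U *v (X *v (\<chi> j. y $ e j))" by (simp add: r_def)
    ultimately show "y \<in> chamber_cone U ?J"
      unfolding chamber_cone_def using cols by blast
  qed
  ultimately show ?thesis using that by blast
qed

text \<open>Shrink the open piece until every \<open>C_I\<close> contains it or misses it. The
  chamber of a point \<open>x\<close> of the piece then contains the piece and lies in the
  hyperplane, so its dimension is squeezed to \<open>n - 1\<close>.\<close>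

lemma fan_skeleton_contains_open:
  fixes U :: "real^'d^'n"
  assumes B: "card B = CARD('d)" and i0: "i0 \<notin> B" "c i0 \<noteq> 0"
    and ker: "\<And>w. (\<And>i. i \<in> B \<Longrightarrow> U $ i \<bullet> w = 0) \<Longrightarrow> w = 0"
    and c: "\<And>i. i \<notin> insert i0 B \<Longrightarrow> c i = 0"
    and rel: "(\<Sum>i\<in>UNIV. c i *\<^sub>R U $ i) = 0"
  obtains N where "openin (top_of_set {y::real^'n. (\<Sum>i\<in>UNIV. c i * y $ i) = 0}) N" "N \<noteq> {}"
    "N \<subseteq> fan_skeleton (CARD('n) - 1) (chamber_complex U)"
proof -
  let ?J = "- insert i0 B"
  let ?H = "{y::real^'n. (\<Sum>i\<in>UNIV. c i * y $ i) = 0}"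
  obtain N0 where N0: "openin (top_of_set ?H) N0" "N0 \<noteq> {}" "N0 \<subseteq> chamber_cone U ?J"
    using chamber_cone_contains_open[OF B i0 ker c rel] .
  have "finite (range (chamber_cone U))" "\<And>S. S \<in> range (chamber_cone U) \<Longrightarrow> closed S"
    using closed_chamber_cone by auto
  from openin_decide_closed_family[OF this N0(1,2)]
  obtain N where N: "openin (top_of_set ?H) N" "N \<noteq> {}" "N \<subseteq> N0"
    and decide: "\<And>I. N \<subseteq> chamber_cone U I \<or> N \<inter> chamber_cone U I = {}"
    by auto
  have dimH: "aff_dim ?H = int (CARD('n) - 1)"
  proof -
    have "?H = {y. (\<chi> i. c i) \<bullet> y = 0}" by (simp add: inner_vec_def)
    moreover have "(\<chi> i. c i) \<noteq> 0" using i0(2) by (metis vec_lambda_beta zero_index)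
    ultimately show ?thesis by (simp add: of_nat_diff)
  qed
  have "x \<in> fan_skeleton (CARD('n) - 1) (chamber_complex U)" if x: "x \<in> N" for x
  proof -
    have xJ: "x \<in> chamber_cone U ?J" using x N N0 by blast
    then have eq: "chamber U x = \<Inter> {chamber_cone U I | I. x \<in> chamber_cone U I}"
      unfolding chamber_def by auto
    have "N \<subseteq> chamber U x"
      unfolding eq using decide x by blast
    moreover have "chamber U x \<subseteq> ?H"
      using xJ chamber_cone_subset[OF rel, of ?J] c unfolding eq by blast
    moreover have "aff_dim N = aff_dim ?H"
      using N(1,2) by (intro aff_dim_openin subspace_imp_affine subspace_linear_form)
    ultimately have "aff_dim (chamber U x) = int (CARD('n) - 1)"
      using aff_dim_subset[of N "chamber U x"] aff_dim_subset[of "chamber U x" ?H] dimH by linarith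
    moreover have "x \<in> chamber U x" unfolding eq by blast
    ultimately show ?thesis
      unfolding fan_skeleton_def cones_of_dim_def chamber_complex_def by blast
  qed
  then show ?thesis using that N(1,2) by blast
qed

section \<open>Zariski density of open pieces of real hyperplanes\<close>

lemma polynomial_fun_on_line:
  assumes "polynomial_fun f"
  shows "\<exists>p. \<forall>s. f (u + s *s v) = poly p s"
  using assms
proof induction
  case (const a)
  show ?case by (rule exI[of _ "[:a:]"]) simp
next
  case (coord i)
  show ?case by (rule exI[of _ "[:u $ i, v $ i:]"]) simp
next
  case (add f g)
  then obtain p q where "\<forall>s. f (u + s *s v) = poly p s" "\<forall>s. g (u + s *s v) = poly q s" by blast
  then show ?case by (intro exI[of _ "p + q"]) simp
next
  case (mult f g)
  then obtain p q where "\<forall>s. f (u + s *s v) = poly p s" "\<forall>s. g (u + s *s v) = poly q s" by blast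
  then show ?case by (intro exI[of _ "p * q"]) simp
qed

text \<open>A univariate complex polynomial with a real interval of roots is zero.\<close>

lemma polynomial_fun_zero_on_line:
  assumes f: "polynomial_fun f" and \<delta>: "\<delta> > 0"
    and zero: "\<And>s::real. \<bar>s\<bar> < \<delta> \<Longrightarrow> f (u + of_real s *s v) = 0"
  shows "f (u + s *s v) = 0"
proof -
  obtain p where p: "\<And>s. f (u + s *s v) = poly p s"
    using polynomial_fun_on_line[OF f] by blast
  have "infinite (complex_of_real ` {-\<delta><..<\<delta>})"
    using \<delta> by (subst finite_image_iff) (auto intro: inj_onI)
  moreover have "complex_of_real ` {-\<delta><..<\<delta>} \<subseteq> {s. poly p s = 0}"
    using zero p by (auto simp: abs_less_iff)
  ultimately have "p = 0"
    using poly_roots_finite finite_subset by blast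
  then show ?thesis by (simp add: p)
qed

text \<open>A polynomial vanishing on a relatively open part of a real hyperplane vanishes on its
  complexification: vary the real and the imaginary part of a point one after the other.\<close>

lemma zariski_closure_open_hyperplane:
  fixes c :: "'n::finite \<Rightarrow> real"
  assumes N: "openin (top_of_set {y::real^'n. (\<Sum>i\<in>UNIV. c i * y $ i) = 0}) N" "N \<noteq> {}"
    and z: "(\<Sum>i\<in>UNIV. of_real (c i) * z $ i) = 0"
  shows "z \<in> zariski_closure (complexify ` N)"
  unfolding zariski_closure_def
proof (intro CollectI allI impI)
  let ?H = "{y::real^'n. (\<Sum>i\<in>UNIV. c i * y $ i) = 0}"
  have H: "subspace ?H" by (rule subspace_linear_form)
  fix f assume f: "polynomial_fun f" and zero: "\<forall>y\<in>complexify ` N. f y = 0"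
  obtain x where x: "x \<in> N" using N(2) by auto
  then have xH: "x \<in> ?H" using openin_imp_subset[OF N(1)] by blast
  \<comment> \<open>With these directions \<open>z\<close> is \<open>x + a + \<i> b\<close>, and
    both \<open>a\<close> and \<open>b\<close> lie in the real hyperplane.\<close>
  define a where "a = (\<chi> i. Re (z $ i)) - x"
  define b where "b = (\<chi> i. Im (z $ i))"
  have "(\<chi> i. Re (z $ i)) \<in> ?H"
    using arg_cong[OF z, of Re] by simp
  then have aH: "a \<in> ?H" unfolding a_def using subspace_diff[OF H] xH by blast
  have bH: "b \<in> ?H"
    using arg_cong[OF z, of Im] by (simp add: b_def)
  obtain \<epsilon> where \<epsilon>: "\<epsilon> > 0" "ball x \<epsilon> \<inter> ?H \<subseteq> N"
    using N(1) x unfolding openin_contains_ball by blast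
  \<comment> \<open>Small enough for both parameters to vary independently inside the ball; the
    summand 1 covers the case where both directions are zero.\<close>
  define \<delta> where "\<delta> = \<epsilon> / (norm a + norm b + 1)"
  have \<delta>: "\<delta> > 0"
    using \<epsilon>(1) by (simp add: \<delta>_def add_nonneg_pos)
  have inN: "x + s *\<^sub>R a + t *\<^sub>R b \<in> N" if s: "\<bar>s\<bar> < \<delta>" and t: "\<bar>t\<bar> < \<delta>" for s t
  proof -
    have "norm (s *\<^sub>R a + t *\<^sub>R b) \<le> \<bar>s\<bar> * norm a + \<bar>t\<bar> * norm b"
      using norm_triangle_ineq[of "s *\<^sub>R a" "t *\<^sub>R b"] by simp
    also have "\<dots> \<le> \<delta> * norm a + \<delta> * norm b"
      using s t by (intro add_mono mult_right_mono) auto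
    also have "\<dots> < \<delta> * (norm a + norm b + 1)"
      using \<delta> by (simp add: algebra_simps)
    also have "\<dots> = \<epsilon>"
    proof -
      have "norm a + norm b + 1 \<noteq> 0"
        using norm_ge_zero[of a] norm_ge_zero[of b] by linarith
      then show ?thesis by (simp add: \<delta>_def)
    qed
    finally have "norm (s *\<^sub>R a + t *\<^sub>R b) < \<epsilon>" .
    moreover have "dist x (x + s *\<^sub>R a + t *\<^sub>R b) = norm (s *\<^sub>R a + t *\<^sub>R b)"
      by (metis add.assoc add_diff_cancel_left' dist_commute dist_norm)
    ultimately have "x + s *\<^sub>R a + t *\<^sub>R b \<in> ball x \<epsilon>" by simp
    moreover have "x + s *\<^sub>R a + t *\<^sub>R b \<in> ?H"
      by (intro subspace_add[OF H] subspace_scale[OF H] xH aH bH)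
    ultimately show ?thesis using \<epsilon>(2) by blast
  qed
  have comp: "complexify (x + s *\<^sub>R a + t *\<^sub>R b)
      = (complexify x + of_real t *s complexify b) + of_real s *s complexify a" for s t
    by (simp add: complexify_def vec_eq_iff)
  \<comment> \<open>First the coefficient of \<open>a\<close> becomes an arbitrary complex number
    for small real \<open>t\<close>; it is then fixed at 1 and the coefficient of \<open>b\<close>
    is continued to \<open>\<i>\<close>.\<close>
  have on_real: "f ((complexify x + of_real t *s complexify b) + s *s complexify a) = 0"
    if t: "\<bar>t\<bar> < \<delta>" for t s
    by (rule polynomial_fun_zero_on_line[OF f \<delta>]) (use zero inN[OF _ t] in \<open>simp add: comp[symmetric]\<close>)
  then have "f ((complexify x + complexify a) + of_real t *s complexify b) = 0"
    if "\<bar>t\<bar> < \<delta>" for t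
    using on_real[OF that, of 1] by (simp add: algebra_simps)
  then have "f ((complexify x + complexify a) + \<i> *s complexify b) = 0"
    by (rule polynomial_fun_zero_on_line[OF f \<delta>])
  moreover have "(complexify x + complexify a) + \<i> *s complexify b = z"
    by (simp add: complexify_def a_def b_def vec_eq_iff complex_eq_iff)
  ultimately show "f z = 0" by simp
qed

lemma zariski_closure_mono: "S \<subseteq> T \<Longrightarrow> zariski_closure S \<subseteq> zariski_closure T"
  unfolding zariski_closure_def by blast

theorem proposition6p3:
  fixes P \<Delta> :: "(real^'d) set" and U :: "real^'d^'n" and k :: nat
  assumes "simple_polytope P"
    and "aff_dim P = int CARD('d)"
    and "card {F. F facet_of P} = CARD('n)"
    and "ray_matrix_of U (normal_fan P)"
    and "\<Delta> face_of P"
    and "k < CARD('d)"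
    and "(int CARD('d) - int k) simplex \<Delta>"
  shows "proj_linear_space (int CARD('n) - int k - 2) (W_space P U \<Delta>)
    \<and> W_space P U \<Delta> \<subseteq>
      adjoint_hypersurface (normal_fan P) U
      \<inter> proj_skeleton_closure (CARD('n) - 1) (chamber_complex U)"
proof -
  obtain C where C: "\<not> affine_dependent C" "int (card C) = int CARD('d) - int k + 1"
    "\<Delta> = convex hull C"
    using assms(7) by (auto simp: simplex_def)
  interpret simplex_face P U \<Delta> C k
    using assms C by unfold_locales auto
  obtain c m where c: "\<And>i. i \<notin> support \<Longrightarrow> c i = 0"
      "(\<Sum>i\<in>UNIV. c i *\<^sub>R U $ i) = 0"
      "\<And>v. v \<in> C \<Longrightarrow> 0 < c (nbr v)"
      "\<And>v. v \<in> C \<Longrightarrow> \<bar>row_minor U (tight {v})\<bar> = m * c (nbr v)"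
      "\<And>x. W P U \<Delta> x = 0 \<longleftrightarrow> (\<Sum>i\<in>UNIV. of_real (c i) * x $ i) = 0"
    using vertex_relation by blast
  obtain v where v: "v \<in> C"
    using \<Delta>_nonempty by (auto simp: \<Delta>_eq)
  \<comment> \<open>The linear space over \<open>W_space\<close>, with the determinant replaced by
    the circuit form.\<close>
  define V where "V = {x::complex^'n. (\<Sum>i\<in>UNIV. of_real (c i) * x $ i) = 0 \<and> (\<forall>i\<in>tight \<Delta>. x $ i = 0)}"
  have W_space: "W_space P U \<Delta> = projectivization V"
    unfolding W_space_def V_def c(5) rays_of_\<Delta> ..
  have "vec.subspace V"
    by (auto simp: V_def vec.subspace_def algebra_simps sum.distrib sum_distrib_left[symmetric])
  moreover have "int (vec.dim V) = (int CARD('n) - int k - 2) + 1"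
  proof -
    \<comment> \<open>The form is independent of the \<open>k\<close> coordinate equations since its
      coefficient at \<open>nbr v\<close>, outside \<open>tight \<Delta>\<close>, is
      nonzero.\<close>
    have "vec.dim V + card (tight \<Delta>) + 1 = CARD('n)"
      unfolding V_def
      by (rule vec_dim_coordinates_and_form[of "nbr v"]) (use nbr(2)[OF v] c(3)[OF v] in auto)
    then show ?thesis by (simp add: card_tight_\<Delta>)
  qed
  ultimately have "proj_linear_space (int CARD('n) - int k - 2) (W_space P U \<Delta>)"
    unfolding proj_linear_space_def W_space by blast
  moreover have "Adj (normal_fan P) U x = 0" if x: "x \<in> V" for x
  proof -
    have x0: "x $ i = 0" if "i \<in> tight \<Delta>" for i
      using x that by (simp add: V_def)
    have "(\<Sum>v\<in>C. of_real \<bar>row_minor U (tight {v})\<bar> * x $ nbr v)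
        = of_real m * (\<Sum>v\<in>C. of_real (c (nbr v)) * x $ nbr v)"
      by (simp add: c(4) sum_distrib_left mult.assoc)
    also have "(\<Sum>v\<in>C. of_real (c (nbr v)) * x $ nbr v) = (\<Sum>i\<in>nbr ` C. of_real (c i) * x $ i)"
      by (simp add: sum.reindex[OF inj_on_nbr])
    \<comment> \<open>The added terms vanish: \<open>x\<close> is zero on
      \<open>tight \<Delta>\<close> and \<open>c\<close> is zero off the support.\<close>
    also have "\<dots> = (\<Sum>i\<in>UNIV. of_real (c i) * x $ i)"
      using c(1) x0 by (intro sum.mono_neutral_left) (auto simp: support_def)
    also have "\<dots> = 0" using x by (simp add: V_def)
    finally show ?thesis by (simp add: Adj_on_face[OF x0])
  qed
  then have "W_space P U \<Delta> \<subseteq> adjoint_hypersurface (normal_fan P) U"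
    unfolding W_space adjoint_hypersurface_def projectivization_def by blast
  moreover have "V \<subseteq> zariski_closure (complexify ` fan_skeleton (CARD('n) - 1) (chamber_complex U))"
  proof -
    \<comment> \<open>Any vertex of \<open>\<Delta>\<close> supplies the basis rows for the chamber
      argument. The whole complex hyperplane, and so \<open>V\<close>, then lies in the Zariski
      closure.\<close>
    have vP: "v extreme_point_of P" using v vertex_iff by simp
    have supp: "support = insert (nbr v) (tight {v})" and notin: "nbr v \<notin> tight {v}"
      using tight_vertex_eq[OF v] v by (auto simp: support_def)
    have "c (nbr v) \<noteq> 0" using c(3)[OF v] by simp
    from fan_skeleton_contains_open[OF card_tight_vertex[OF vP] notin this vertex_kernel[OF vP]
        c(1)[unfolded supp] c(2)]
    obtain N where N: "openin (top_of_set {y::real^'n. (\<Sum>i\<in>UNIV. c i * y $ i) = 0}) N" "N \<noteq> {}"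
      "N \<subseteq> fan_skeleton (CARD('n) - 1) (chamber_complex U)" .
    then have "V \<subseteq> zariski_closure (complexify ` N)"
      using zariski_closure_open_hyperplane[OF N(1,2)] by (auto simp: V_def)
    then show ?thesis
      using zariski_closure_mono[OF image_mono[OF N(3)]] by blast
  qed
  then have "W_space P U \<Delta> \<subseteq> proj_skeleton_closure (CARD('n) - 1) (chamber_complex U)"
    unfolding W_space proj_skeleton_closure_def projectivization_def by blast
  ultimately show ?thesis by blast
qed

end
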